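(* Let $\rho:\mathbb{R}^d\to(0,\infty)$ be a critical radius function. Let $\theta\ge0$, $0\le\alpha<d$, $1\le p\le q<\infty$ with $1/p-1/q=\alpha/d$. Let $(U,V)$ be a pair of matrix weights. (1) If $(U,V)\in\mathcal{A}_{p,q}^{\rho,\theta/3}$, then for all $\vec f\in L^p(\mathbb{R}^d,\mathbb{C}^n)$ and all cubes $Q$, $$\max\big\{\|M_{\mathcal{U},V,\psi_\theta,\alpha}\vec f\|_{L^{q,\infty}},\ \|\mathcal{A}_Q^{\alpha,\theta}\vec f\|_{L^{q,\infty}}\big\}\lesssim[U,V]_{\mathcal{A}_{p,q}^{\rho,\theta/3}}^{1/q}\|\vec f\|_{L^p},$$ where the implicit constant is independent of $Q$. (2) If $M_{\mathcal{U},V,\psi_\theta,\alpha}$ is bounded from $L^p$ to $L^{q,\infty}$, or if the operators $\mathcal{A}_Q^{\alpha,\theta}$ are bounded from $L^p$ to $L^{q,\infty}$ with norm bounded independently of the cube $Q$, then $(U,V)\in\mathcal{A}_{p,q}^{\rho,\theta}$.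
   Context: Critical radius function: $\rho:\mathbb{R}^d\to(0,\infty)$ for which there are constants $C_0,N_0>0$ with $C_0^{-1}\rho(x)(1+\frac{|x-y|}{\rho(x)})^{-N_0}\le\rho(y)\le C_0\rho(x)(1+\frac{|x-y|}{\rho(x)})^{\frac{N_0}{N_0+1}}$ for all $x,y\in\mathbb{R}^d$. For a cube $Q\subset\mathbb{R}^d$ with center $x_Q$ and side-length $l_Q$, $\psi_\theta(Q):=(1+l_Q/\rho(x_Q))^\theta$. A matrix weight $W:\mathbb{R}^d\to\mathbb{C}^{n\times n}$ is a self-adjoint matrix function with locally integrable entries which is positive definite almost everywhere; powers are defined by the spectral calculus. $|\cdot|_{op}$ is the operator norm. $(U,V)\in\mathcal{A}_{p,q}^{\rho,\theta}$ means that the following is finite (suprema over all cubes): for $1<p\le q<\infty$, $$[U,V]_{\mathcal{A}_{p,q}^{\rho,\theta}}:=\sup_Q\frac{1}{\psi_\theta(Q)|Q|}\int_Q\Big(\frac{1}{\psi_\theta(Q)|Q|}\int_Q|U(x)^{1/q}V(y)^{-1/q}|_{op}^{p'}dy\Big)^{q/p'}dx;$$ for $p=1\le q<\infty$, $$[U,V]_{\mathcal{A}_{1,q}^{\rho,\theta}}:=\sup_Q\operatorname*{ess\,sup}_{y\in Q}\frac{1}{\psi_\theta(Q)|Q|}\int_Q|U(x)^{1/q}V(y)^{-1/q}|_{op}^q\,dx.$$ For each cube $Q$, $\mathcal{U}_Q^{q,q}$ is a reducing operator: a positive definite $n\times n$ matrix with $|\mathcal{U}_Q^{q,q}\vec e|\sim\big(\frac1{|Q|}\int_Q|U(x)^{1/q}\vec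 e|^qdx\big)^{1/q}$ for all $\vec e\in\mathbb{C}^n$, with constants independent of $Q$ and $\vec e$. Define $$M_{\mathcal{U},V,\psi_\theta,\alpha}\vec f(x):=\sup_{Q\ni x}\frac{1}{(\psi_\theta(Q)|Q|)^{1-\alpha/d}}\int_Q|\mathcal{U}_Q^{q,q}V(y)^{-1/q}\vec f(y)|dy,$$ $$\mathcal{A}_Q^{\alpha,\theta}\vec f(x):=\frac{1}{(\psi_\theta(Q)|Q|)^{1-\alpha/d}}\int_Q|\mathcal{U}_Q^{q,q}V(y)^{-1/q}\vec f(y)|dy\ \chi_Q(x).$$ $\|\vec f\|_{L^p}=\||\vec f|\|_{L^p(\mathbb{R}^d)}$; $L^{q,\infty}$ is weak $L^q$ with $\|g\|_{L^{q,\infty}}=\sup_{\lambda>0}\lambda|\{|g|>\lambda\}|^{1/q}$. $A\lesssim B$ means $A\le CB$ with $C$ independent of $U,V,\vec f$ (and $Q$). *)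

theory Defs
  imports "HOL-Analysis.Analysis" "HOL-Probability.Essential_Supremum"
begin

section \<open>Extended nonnegative reals and Lebesgue norms\<close>

text \<open>Only used with a positive exponent.\<close>
definition epowr :: "ennreal \<Rightarrow> real \<Rightarrow> ennreal" where
  "epowr x a = (if x = \<infinity> then \<infinity> else ennreal (enn2real x powr a))"

definition Lp_norm :: "real \<Rightarrow> (real^'d \<Rightarrow> complex^'n) \<Rightarrow> ennreal" where
  "Lp_norm p f = epowr (\<integral>\<^sup>+x. ennreal (norm (f x) powr p) \<partial>lebesgue) (1 / p)"

definition Lp_space :: "real \<Rightarrow> (real^'d \<Rightarrow> complex^'n) set" where
  "Lp_space p = {f \<in> borel_measurable lebesgue. Lp_norm p f < \<infinity>}"

text \<open>The operators below take values in \<open>[0,\<infinity>]\<close>, so no absolute value is needed.\<close>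
definition weak_Lp_norm :: "real \<Rightarrow> (real^'d \<Rightarrow> ennreal) \<Rightarrow> ennreal" where
  "weak_Lp_norm q g =
     (SUP t\<in>{0::real<..}. ennreal t * epowr (emeasure lebesgue {x. g x > ennreal t}) (1 / q))"

definition bounded_Lp_weak_Lq ::
  "real \<Rightarrow> real \<Rightarrow> ((real^'d \<Rightarrow> complex^'n) \<Rightarrow> real^'d \<Rightarrow> ennreal) \<Rightarrow> real \<Rightarrow> bool" where
  "bounded_Lp_weak_Lq p q T C \<longleftrightarrow>
     (\<forall>f\<in>Lp_space p. weak_Lp_norm q (T f) \<le> ennreal C * Lp_norm p f)"

section \<open>Critical radius functions and cubes\<close>

definition critical_radius :: "(real^'d \<Rightarrow> real) \<Rightarrow> bool" where
  "critical_radius \<rho> \<longleftrightarrow> (\<forall>x. 0 < \<rho> x) \<and>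
     (\<exists>C0>0. \<exists>N0>0. \<forall>x y.
        inverse C0 * \<rho> x * (1 + norm (x - y) / \<rho> x) powr (- N0) \<le> \<rho> y \<and>
        \<rho> y \<le> C0 * \<rho> x * (1 + norm (x - y) / \<rho> x) powr (N0 / (N0 + 1)))"

text \<open>
  A cube is open, has sides parallel to the axes, and is given by its center \<open>c\<close> and its
  side-length \<open>l > 0\<close>. As these are determined by the cube, a family indexed by the cubes is a
  function of \<open>c\<close> and \<open>l\<close>.
\<close>
definition cube :: "real^'d \<Rightarrow> real \<Rightarrow> (real^'d) set" where
  "cube c l = box (c - vec (l / 2)) (c + vec (l / 2))"

definition vol :: "real^'d \<Rightarrow> real \<Rightarrow> real" where
  "vol c l = measure lebesgue (cube c l)"

definition psi :: "(real^'d \<Rightarrow> real) \<Rightarrow> real \<Rightarrow> real^'d \<Rightarrow> real \<Rightarrow> real" where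
  "psi \<rho> \<theta> c l = (1 + l / \<rho> c) powr \<theta>"

section \<open>Matrix weights\<close>

definition cadjoint :: "complex^'n^'n \<Rightarrow> complex^'n^'n" where
  "cadjoint A = (\<chi> i j. cnj (A $ j $ i))"

definition self_adjoint :: "complex^'n^'n \<Rightarrow> bool" where
  "self_adjoint A \<longleftrightarrow> cadjoint A = A"

text \<open>The real inner product of \<^typ>\<open>complex^'n\<close> is the real part of the Hermitian one.\<close>
definition positive_definite :: "complex^'n^'n \<Rightarrow> bool" where
  "positive_definite A \<longleftrightarrow> self_adjoint A \<and> (\<forall>e. e \<noteq> 0 \<longrightarrow> 0 < (A *v e) \<bullet> e)"

definition unitary_matrix :: "complex^'n^'n \<Rightarrow> bool" where
  "unitary_matrix P \<longleftrightarrow> P ** cadjoint P = mat 1 \<and> cadjoint P ** P = mat 1"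

definition real_diag :: "('n \<Rightarrow> real) \<Rightarrow> complex^'n^'n" where
  "real_diag a = (\<chi> i j. if i = j then of_real (a i) else 0)"

text \<open>
  Spectral calculus of self-adjoint matrices. The matrix \<open>B\<close> exists by the spectral theorem, and
  it does not depend on the chosen diagonalization.
\<close>
definition spectral_calculus :: "(real \<Rightarrow> real) \<Rightarrow> complex^'n^'n \<Rightarrow> complex^'n^'n" where
  "spectral_calculus h A =
     (THE B. \<exists>P a. unitary_matrix P \<and> A = P ** real_diag a ** cadjoint P \<and>
                   B = P ** real_diag (h \<circ> a) ** cadjoint P)"

definition matrix_powr :: "complex^'n^'n \<Rightarrow> real \<Rightarrow> complex^'n^'n" where
  "matrix_powr A s = spectral_calculus (\<lambda>t. t powr s) A"

text \<open>
  The real operator norm of a complex-linear map on \<^typ>\<open>complex^'n\<close> is its complex one.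
\<close>
definition op_norm :: "complex^'n^'n \<Rightarrow> real" where
  "op_norm A = onorm ((*v) A)"

definition matrix_weight :: "(real^'d \<Rightarrow> complex^'n^'n) \<Rightarrow> bool" where
  "matrix_weight W \<longleftrightarrow>
     (\<forall>x. self_adjoint (W x)) \<and>
     (\<forall>i j K. compact K \<longrightarrow> (\<lambda>x. W x $ i $ j) absolutely_integrable_on K) \<and>
     (AE x in lebesgue. positive_definite (W x))"

section \<open>The two-weight classes\<close>

definition Apq_const ::
  "real \<Rightarrow> real \<Rightarrow> (real^'d \<Rightarrow> real) \<Rightarrow> real \<Rightarrow>
   (real^'d \<Rightarrow> complex^'n^'n) \<Rightarrow> (real^'d \<Rightarrow> complex^'n^'n) \<Rightarrow> ennreal" where
  "Apq_const p q \<rho> \<theta> U V =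
     (if p = 1 then
        (SUP (c, l)\<in>UNIV \<times> {0<..}.
           esssup (restrict_space lebesgue (cube c l))
             (\<lambda>y. ennreal (1 / (psi \<rho> \<theta> c l * vol c l)) *
                (\<integral>\<^sup>+x\<in>cube c l. ennreal (op_norm
                   (matrix_powr (U x) (1 / q) ** matrix_powr (V y) (- 1 / q)) powr q) \<partial>lebesgue)))
      else
        (let p' = p / (p - 1) in
         SUP (c, l)\<in>UNIV \<times> {0<..}.
           ennreal (1 / (psi \<rho> \<theta> c l * vol c l)) *
           (\<integral>\<^sup>+x\<in>cube c l.
              epowr (ennreal (1 / (psi \<rho> \<theta> c l * vol c l)) *
                (\<integral>\<^sup>+y\<in>cube c l. ennreal (op_norm
                   (matrix_powr (U x) (1 / q) ** matrix_powr (V y) (- 1 / q)) powr p') \<partial>lebesgue))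
              (q / p') \<partial>lebesgue)))"

definition Apq_class ::
  "real \<Rightarrow> real \<Rightarrow> (real^'d \<Rightarrow> real) \<Rightarrow> real \<Rightarrow>
   ((real^'d \<Rightarrow> complex^'n^'n) \<times> (real^'d \<Rightarrow> complex^'n^'n)) set" where
  "Apq_class p q \<rho> \<theta> = {(U, V). Apq_const p q \<rho> \<theta> U V < \<infinity>}"

section \<open>Reducing operators and averaging operators\<close>

text \<open>
  \<open>R c l\<close> is the reducing operator of the cube with center \<open>c\<close> and side-length \<open>l\<close>;
  \<open>K1\<close> and \<open>K2\<close> are the constants hidden in the equivalence of norms.
\<close>
definition reducing_operators ::
  "real \<Rightarrow> real \<Rightarrow> real \<Rightarrow> (real^'d \<Rightarrow> complex^'n^'n) \<Rightarrow>
   (real^'d \<Rightarrow> real \<Rightarrow> complex^'n^'n) \<Rightarrow> bool" where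
  "reducing_operators K1 K2 q U R \<longleftrightarrow>
     (\<forall>c l. 0 < l \<longrightarrow> positive_definite (R c l) \<and>
       (\<forall>e. let avg = epowr (ennreal (1 / vol c l) *
                        (\<integral>\<^sup>+x\<in>cube c l. ennreal (norm (matrix_powr (U x) (1 / q) *v e) powr q)
                         \<partial>lebesgue)) (1 / q)
            in ennreal K1 * avg \<le> ennreal (norm (R c l *v e)) \<and>
               ennreal (norm (R c l *v e)) \<le> ennreal K2 * avg))"

definition cube_mean ::
  "(real^'d \<Rightarrow> real) \<Rightarrow> real \<Rightarrow> real \<Rightarrow> real \<Rightarrow> (real^'d \<Rightarrow> real \<Rightarrow> complex^'n^'n) \<Rightarrow>
   (real^'d \<Rightarrow> complex^'n^'n) \<Rightarrow> real^'d \<Rightarrow> real \<Rightarrow> (real^'d \<Rightarrow> complex^'n) \<Rightarrow> ennreal" where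
  "cube_mean \<rho> \<theta> \<alpha> q R V c l f =
     ennreal (1 / (psi \<rho> \<theta> c l * vol c l) powr (1 - \<alpha> / real CARD('d))) *
     (\<integral>\<^sup>+y\<in>cube c l. ennreal (norm (R c l *v (matrix_powr (V y) (- 1 / q) *v f y))) \<partial>lebesgue)"

definition maximal_op ::
  "(real^'d \<Rightarrow> real) \<Rightarrow> real \<Rightarrow> real \<Rightarrow> real \<Rightarrow> (real^'d \<Rightarrow> real \<Rightarrow> complex^'n^'n) \<Rightarrow>
   (real^'d \<Rightarrow> complex^'n^'n) \<Rightarrow> (real^'d \<Rightarrow> complex^'n) \<Rightarrow> real^'d \<Rightarrow> ennreal" where
  "maximal_op \<rho> \<theta> \<alpha> q R V f x =
     (SUP (c, l)\<in>{(c, l). 0 < l \<and> x \<in> cube c l}. cube_mean \<rho> \<theta> \<alpha> q R V c l f)"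

definition averaging_op ::
  "(real^'d \<Rightarrow> real) \<Rightarrow> real \<Rightarrow> real \<Rightarrow> real \<Rightarrow> (real^'d \<Rightarrow> real \<Rightarrow> complex^'n^'n) \<Rightarrow>
   (real^'d \<Rightarrow> complex^'n^'n) \<Rightarrow> real^'d \<Rightarrow> real \<Rightarrow> (real^'d \<Rightarrow> complex^'n) \<Rightarrow> real^'d \<Rightarrow> ennreal" where
  "averaging_op \<rho> \<theta> \<alpha> q R V c l f x = cube_mean \<rho> \<theta> \<alpha> q R V c l f * indicator (cube c l) x"

end

(*
Part (1). Each component of the integral of |R (V^(-1/q) f)| over Q is (R w) . b for the vector
integral w of the suitably signed V^(-1/q) f, so the reducing property of R, Hoelder's inequality
and the A_{p,q} condition bound the average over Q by A^(1/q) |Q|^(-1/q) times the L^p norm of f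
on Q. A cube in the level set of height t hence satisfies |Q| <= (B/t)^q (int_Q |f|^p)^(q/p); as
q >= p, the right-hand side is superadditive over disjoint cubes, and Vitali's covering lemma gives
the weak-type bound.

Part (2). The averages are dominated by the maximal function. Testing them on the extremal functions
of Hoelder's inequality (indicators of level sets if p = 1) bounds the L^p' norm of
|R V^(-1/q)| on Q, and U^(1/q) V^(-1/q) = (U^(1/q) R^(-1)) (R V^(-1/q)), where the first factor is
controlled by the reducing property.

Matrix powers enter only through their measurability: on positive definite matrices they are limits
of polynomial maps.
*)
theory Submission
  imports Defs
begin

section \<open>The spectral theorem and measurability of matrix powers\<close>

text \<open>Both halves hinge on one scalar per cube, the mean over Q times |Q|^(1/q). The averaging
  operator is constant on Q, so its weak norm controls this scalar. The first half bounds it by the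
  L^p norm of f on Q, and the second half starts from such a bound. The normalizations fit because 1
  - \<alpha>/d = 1/q + 1/p', where p' is the conjugate exponent: the power of \<psi>(Q)|Q| in the
  mean is the product of those in the outer and inner averages of the class. The obstacle is the
  order of integration. The class takes the L^p' norm in y first and the L^q norm in x afterwards.
  Using the reducing property under the integral in y would produce the opposite order, and mixed
  norms cannot be interchanged for general exponents. Using it once, on an already integrated
  vector, keeps the order of the class. In the second half the inverse of the reducing operator
  splits the kernel into a function of x times a function of y, so that the order ceases to
  matter.\<close>

definition hinner :: "complex^'n \<Rightarrow> complex^'n \<Rightarrow> complex" where
  "hinner x y = (\<Sum>i\<in>UNIV. x $ i * cnj (y $ i))"

text \<open>The library inner product of \<open>complex^'n\<close> is real-valued, and orthogonality
  for it is too weak for the columns of a unitary matrix. Both products are kept: the real one for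
  positivity and extremal arguments, \<open>hinner\<close> for orthonormality.\<close>

lemma Re_hinner: "Re (hinner x y) = x \<bullet> y"
  by (simp add: hinner_def inner_vec_def inner_complex_def)

lemma hinner_self: "hinner x x = of_real ((norm x)\<^sup>2)"
proof -
  have "Im (hinner x x) = 0"
    by (simp add: hinner_def)
  then show ?thesis
    by (simp add: complex_eq_iff Re_hinner power2_norm_eq_inner)
qed

lemma hinner_commute: "hinner y x = cnj (hinner x y)"
  by (simp add: hinner_def mult.commute)

lemma hinner_add_left: "hinner (x + y) z = hinner x z + hinner y z"
  by (simp add: hinner_def algebra_simps sum.distrib)

lemma hinner_scaleR_left: "hinner (c *\<^sub>R x) z = of_real c * hinner x z"
  unfolding hinner_def sum_distrib_left
  by (rule sum.cong) (simp_all add: scaleR_conv_of_real[where 'a=complex])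

lemma hinner_scaleR_right: "hinner x (c *\<^sub>R z) = of_real c * hinner x z"
  unfolding hinner_def sum_distrib_left
  by (rule sum.cong) (simp_all add: scaleR_conv_of_real[where 'a=complex])

lemma hinner_matrix_left: "hinner (A *v x) y = hinner x (cadjoint A *v y)"
proof -
  have "hinner (A *v x) y = (\<Sum>i\<in>UNIV. \<Sum>j\<in>UNIV. A$i$j * x$j * cnj (y$i))"
    by (simp add: hinner_def matrix_vector_mult_def sum_distrib_right)
  also have "\<dots> = (\<Sum>j\<in>UNIV. \<Sum>i\<in>UNIV. A$i$j * x$j * cnj (y$i))"
    by (rule sum.swap)
  also have "\<dots> = hinner x (cadjoint A *v y)"
    by (simp add: hinner_def matrix_vector_mult_def cadjoint_def sum_distrib_left mult_ac)
  finally show ?thesis .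
qed

section \<open>Diagonalization of self-adjoint matrices\<close>

lemma inner_self_adjoint:
  assumes "self_adjoint A"
  shows "(A *v x) \<bullet> y = x \<bullet> (A *v y)"
  using assms by (simp add: self_adjoint_def hinner_matrix_left flip: Re_hinner)

lemma matrix_mult_scaleR: "(A :: complex^'n^'m) *v (c *\<^sub>R x) = c *\<^sub>R (A *v x)"
  by (simp add: vec_eq_iff matrix_vector_mult_def scaleR_sum_right)

lemma linear_complex_matrix: "linear ((*v) (A :: complex^'n^'m))"
  by (rule linearI) (simp_all add: matrix_vector_right_distrib matrix_mult_scaleR)

lemma bounded_linear_complex_matrix: "bounded_linear ((*v) (A :: complex^'n^'m))"
  by (rule linear_conv_bounded_linear[THEN iffD1, OF linear_complex_matrix])

text \<open>A maximizer of the quadratic form on the unit sphere of an invariant subspace is an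
  eigenvector.\<close>
lemma eigenvector_in_invariant_subspace:
  fixes A :: "complex^'n^'n"
  assumes A: "self_adjoint A" and S: "subspace S" and inv: "\<And>x. x \<in> S \<Longrightarrow> A *v x \<in> S"
    and nz: "y \<in> S" "y \<noteq> 0"
  obtains x and l :: real where "x \<in> S" "norm x = 1" "A *v x = l *\<^sub>R x"
proof -
  define K where "K = S \<inter> sphere 0 1"
  have "compact K" unfolding K_def
    using S by (simp add: closed_Int_compact closed_subspace)
  moreover have "y /\<^sub>R norm y \<in> K"
    using nz S by (simp add: K_def subspace_scale)
  moreover have "continuous_on K (\<lambda>x. (A *v x) \<bullet> x)"
    by (intro continuous_intros linear_continuous_on bounded_linear_complex_matrix)
  ultimately obtain x where x: "x \<in> K" and mx: "\<And>z. z \<in> K \<Longrightarrow> (A *v z) \<bullet> z \<le> (A *v x) \<bullet> x"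
    using continuous_attains_sup[of K "\<lambda>x. (A *v x) \<bullet> x"] by blast
  define l where "l = (A *v x) \<bullet> x"
  have xS: "x \<in> S" and nx: "norm x = 1" using x by (auto simp: K_def)
  have le: "(A *v z) \<bullet> z \<le> l * (z \<bullet> z)" if z: "z \<in> S" for z
  proof (cases "z = 0")
    case False
    have "z /\<^sub>R norm z \<in> K" using z False S by (simp add: K_def subspace_scale)
    from mx[OF this] have "(A *v z) \<bullet> z / (norm z * norm z) \<le> l"
      by (simp add: matrix_mult_scaleR l_def field_simps)
    then show ?thesis using False
      by (simp add: dot_square_norm power2_eq_square field_simps)
  qed simp
  define w where "w = A *v x - l *\<^sub>R x"
  have wS: "w \<in> S" unfolding w_def using S xS inv by (intro subspace_diff subspace_scale) auto
  \<comment> \<open>First variation at the maximizer, in the direction of the residual: in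
    \<open>le\<close> at x + t w the terms of order zero cancel by the choice of \<open>l\<close>,
    and division by \<open>t\<close> leaves the first-order term against an error of order
    \<open>t\<close>.\<close>
  have main: "2 * (w \<bullet> w) \<le> t * (l * (w \<bullet> w) - (A *v w) \<bullet> w)" if t: "t > 0" for t :: real
  proof -
    have "x + t *\<^sub>R w \<in> S" using S xS wS by (intro subspace_add subspace_scale)
    from le[OF this] have "(A *v x) \<bullet> x + t * ((A *v x) \<bullet> w) + t * ((A *v w) \<bullet> x) + t*t*((A *v w) \<bullet> w)
       \<le> l * (x \<bullet> x + 2 * t * (x \<bullet> w) + t * t * (w \<bullet> w))"
      by (simp add: matrix_vector_right_distrib matrix_mult_scaleR inner_simps algebra_simps
          inner_commute)
    moreover have "(A *v w) \<bullet> x = (A *v x) \<bullet> w"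
      using inner_self_adjoint[OF A, of w x] by (simp add: inner_commute)
    moreover have "x \<bullet> x = 1" using nx by (simp add: dot_square_norm)
    moreover have "t * ((A *v x) \<bullet> w - l * (x \<bullet> w)) = t * (w \<bullet> w)"
      by (simp add: w_def inner_diff_left)
    ultimately have "t * (2 * (w \<bullet> w)) \<le> t * (t * (l * (w \<bullet> w) - (A *v w) \<bullet> w))"
      unfolding l_def[symmetric] by (simp add: algebra_simps)
    then show ?thesis using t by simp
  qed
  have "w \<bullet> w \<le> 0"
  proof (rule ccontr)
    assume "\<not> ?thesis"
    then have pos: "w \<bullet> w > 0" by linarith
    define B where "B = l * (w \<bullet> w) - (A *v w) \<bullet> w"
    \<comment> \<open>For this \<open>t\<close> the right-hand side of \<open>main\<close> is at
      most \<open>w \<bullet> w\<close>, half of what the left-hand side demands.\<close>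
    have "(w \<bullet> w) / (\<bar>B\<bar> + 1) > 0" using pos by simp
    from main[OF this] have "2 * (w \<bullet> w) \<le> (w \<bullet> w) / (\<bar>B\<bar> + 1) * B" by (simp add: B_def)
    also have "\<dots> \<le> (w \<bullet> w) / (\<bar>B\<bar> + 1) * (\<bar>B\<bar> + 1)" using pos by (intro mult_left_mono) auto
    also have "\<dots> = w \<bullet> w" by simp
    finally show False using pos by simp
  qed
  then have "w = 0" by (metis inner_ge_zero inner_eq_zero_iff order_antisym)
  then show ?thesis using that[OF xS nx, of l] by (simp add: w_def)
qed

lemma mult_if_delta_complex:
  "(x :: complex) * (if Q then y else 0) = (if Q then x * y else 0)"
  "(if Q then y else 0) * (x :: complex) = (if Q then y * x else 0)"
  by simp_all

lemma real_diag_mult: "real_diag a ** real_diag b = real_diag (\<lambda>i. a i * b i)"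
  by (simp add: vec_eq_iff real_diag_def matrix_matrix_mult_def mult_if_delta_complex)

text \<open>The orthogonal complement of the eigenvectors found so far is invariant, as A is
  self-adjoint and the eigenvalues are real, and it is nonzero as long as an index is left. A
  maximizer of the quadratic form there supplies the next eigenvector. The vectors are indexed by
  elements of \<open>'n\<close>, so that they can serve as rows and columns of a matrix.\<close>

lemma orthonormal_eigenvectors:
  fixes A :: "complex^'n^'n"
  assumes A: "self_adjoint A" and "finite (I :: 'n set)"
  shows "\<exists>v \<mu>. \<forall>i\<in>I. A *v v i = (\<mu> i :: real) *\<^sub>R v i \<and>
           (\<forall>j\<in>I. hinner (v i) (v j) = (if i = j then 1 else 0))"
  using \<open>finite I\<close>
proof (induction I rule: finite_induct)
  case (insert k I)
  then obtain v and \<mu> :: "'n \<Rightarrow> real" where v: "\<And>i. i \<in> I \<Longrightarrow> A *v v i = \<mu> i *\<^sub>R v i"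
    and orth: "\<And>i j. i \<in> I \<Longrightarrow> j \<in> I \<Longrightarrow> hinner (v i) (v j) = (if i = j then 1 else 0)"
    by blast
  define S where "S = {x. \<forall>i\<in>I. hinner x (v i) = 0}"
  have S: "subspace S"
    by (auto simp: S_def subspace_def hinner_add_left hinner_scaleR_left hinner_def[of 0])
  have inv: "A *v x \<in> S" if "x \<in> S" for x
    using that A v by (simp add: S_def hinner_matrix_left self_adjoint_def hinner_scaleR_right)
  \<comment> \<open>The dimension count, by determinants: the kernel of \<open>B\<close> is exactly
    \<open>S\<close>, and the row of \<open>B\<close> at the new index \<open>k\<close> vanishes, so
    \<open>B\<close> is singular and \<open>S\<close> contains a nonzero vector.\<close>
  define B where "B = (\<chi> i j. if i \<in> I then cnj (v i $ j) else 0)"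
  have "row k B = 0" using insert by (simp add: row_def B_def vec_eq_iff)
  then have "det B = 0" by (rule det_zero_row)
  then have "\<not> (\<exists>C. C ** B = mat 1)"
    by (metis invertible_det_nz invertible_left_inverse)
  then obtain y where y: "B *v y = 0" "y \<noteq> 0" unfolding matrix_left_invertible_ker by blast
  have "hinner y (v i) = 0" if "i \<in> I" for i
  proof -
    have "(B *v y) $ i = 0" using y by simp
    then show ?thesis using that
      by (simp add: hinner_def matrix_vector_mult_def B_def mult.commute)
  qed
  then have "y \<in> S" by (simp add: S_def)
  from eigenvector_in_invariant_subspace[OF A S inv this y(2)]
  obtain x l where x: "x \<in> S" "norm x = 1" "A *v x = l *\<^sub>R x" by metis
  have xv: "hinner x (v i) = 0" "hinner (v i) x = 0" if "i \<in> I" for i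
    using x that by (auto simp: S_def hinner_commute[of "v i" x])
  show ?case
    using v orth x xv insert.hyps
    by (intro exI[of _ "v(k := x)"] exI[of _ "\<mu>(k := l)"]) (auto simp: hinner_self[of x])
qed simp

theorem spectral_theorem:
  fixes A :: "complex^'n^'n"
  assumes A: "self_adjoint A"
  obtains P a where "unitary_matrix P" "A = P ** real_diag a ** cadjoint P"
proof -
  obtain v and \<mu> :: "'n \<Rightarrow> real" where v: "\<And>i. A *v v i = \<mu> i *\<^sub>R v i"
    and orth: "\<And>i j. hinner (v i) (v j) = (if i = j then 1 else 0)"
    using orthonormal_eigenvectors[OF A, of UNIV] by auto
  define P where "P = (\<chi> i j. v j $ i)"
  have "cadjoint P ** P = mat 1"
  proof -
    have "(cadjoint P ** P) $ i $ j = hinner (v j) (v i)" for i j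
      by (simp add: matrix_matrix_mult_def cadjoint_def P_def hinner_def mult.commute)
    then show ?thesis by (simp add: vec_eq_iff mat_def orth)
  qed
  moreover from this have "P ** cadjoint P = mat 1" by (simp add: matrix_left_right_inverse)
  ultimately have un: "unitary_matrix P" by (simp add: unitary_matrix_def)
  have "A ** P = P ** real_diag \<mu>"
  proof -
    have "(A ** P) $ i $ j = (P ** real_diag \<mu>) $ i $ j" for i j
    proof -
      have "(A ** P) $ i $ j = (A *v v j) $ i"
        by (simp add: matrix_matrix_mult_def matrix_vector_mult_def P_def)
      also have "\<dots> = of_real (\<mu> j) * v j $ i" by (simp add: v scaleR_conv_of_real[where 'a=complex])
      also have "\<dots> = (P ** real_diag \<mu>) $ i $ j"
        by (simp add: matrix_matrix_mult_def P_def real_diag_def mult_if_delta_complex mult.commute)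
      finally show ?thesis .
    qed
    then show ?thesis by (simp add: vec_eq_iff)
  qed
  then have "A = P ** real_diag \<mu> ** cadjoint P"
    using un by (metis matrix_mul_assoc matrix_mul_rid unitary_matrix_def)
  with un that show ?thesis by blast
qed

section \<open>Polynomial calculus, and matrix powers as limits of polynomials\<close>

primrec mpow :: "complex^'n^'n \<Rightarrow> nat \<Rightarrow> complex^'n^'n" where
  "mpow A 0 = mat 1"
| "mpow A (Suc k) = A ** mpow A k"

definition mpoly :: "(nat \<Rightarrow> real) \<Rightarrow> nat \<Rightarrow> complex^'n^'n \<Rightarrow> complex^'n^'n" where
  "mpoly c m A = (\<Sum>k\<le>m. c k *\<^sub>R mpow A k)"

lemma mpow_diagonalized:
  assumes "unitary_matrix P"
  shows "mpow (P ** real_diag a ** cadjoint P) k = P ** real_diag (\<lambda>i. a i ^ k) ** cadjoint P"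
proof (induction k)
  case 0
  have "real_diag (\<lambda>i. a i ^ 0) = mat 1" by (simp add: vec_eq_iff real_diag_def mat_def)
  with assms show ?case by (simp add: unitary_matrix_def)
next
  case (Suc k)
  have "mpow (P ** real_diag a ** cadjoint P) (Suc k) =
      P ** real_diag a ** (cadjoint P ** P) ** real_diag (\<lambda>i. a i ^ k) ** cadjoint P"
    by (simp add: Suc matrix_mul_assoc)
  also have "\<dots> = P ** (real_diag a ** real_diag (\<lambda>i. a i ^ k)) ** cadjoint P"
    using assms by (simp add: unitary_matrix_def matrix_mul_assoc)
  finally show ?case by (simp add: real_diag_mult)
qed

text \<open>Each entry is a finite sum, linear in the diagonal values, so linear combinations and
  limits of functions of the eigenvalues carry over to the matrices entry by entry.\<close>

lemma conj_entry:
  "(P ** real_diag a ** Q) $ i $ j = (\<Sum>k\<in>UNIV. P $ i $ k * of_real (a k) * Q $ k $ j)"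
  by (simp add: matrix_matrix_mult_def real_diag_def mult_if_delta_complex)

lemma mpoly_diagonalized:
  assumes "unitary_matrix P"
  shows "mpoly c m (P ** real_diag a ** cadjoint P) =
    P ** real_diag (\<lambda>i. \<Sum>k\<le>m. c k * a i ^ k) ** cadjoint P"
proof -
  define Q where "Q = cadjoint P"
  have "mpoly c m (P ** real_diag a ** Q) $ i $ j =
      (P ** real_diag (\<lambda>i. \<Sum>k\<le>m. c k * a i ^ k) ** Q) $ i $ j" for i j
  proof -
    have "of_real (c k) * mpow (P ** real_diag a ** Q) k $ i $ j =
      (\<Sum>r\<in>UNIV. P $ i $ r * of_real (c k * a r ^ k) * Q $ r $ j)" for k
    proof -
      have "of_real (c k) * mpow (P ** real_diag a ** Q) k $ i $ j =
        (\<Sum>r\<in>UNIV. of_real (c k) * (P $ i $ r * of_real (a r ^ k) * Q $ r $ j))"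
        unfolding Q_def mpow_diagonalized[OF assms] conj_entry by (rule sum_distrib_left)
      also have "\<dots> = (\<Sum>r\<in>UNIV. P $ i $ r * of_real (c k * a r ^ k) * Q $ r $ j)"
        by (rule sum.cong) (simp_all add: mult.assoc mult.left_commute)
      finally show ?thesis .
    qed
    then have "mpoly c m (P ** real_diag a ** Q) $ i $ j =
        (\<Sum>k\<le>m. \<Sum>r\<in>UNIV. P $ i $ r * of_real (c k * a r ^ k) * Q $ r $ j)"
      unfolding mpoly_def sum_component vector_scaleR_component scaleR_conv_of_real[where 'a=complex]
      by (rule sum.cong[OF refl])
    also have "\<dots> = (\<Sum>r\<in>UNIV. \<Sum>k\<le>m. P $ i $ r * of_real (c k * a r ^ k) * Q $ r $ j)"
      by (rule sum.swap)
    also have "\<dots> = (P ** real_diag (\<lambda>i. \<Sum>k\<le>m. c k * a i ^ k) ** Q) $ i $ j"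
      unfolding conj_entry of_real_sum sum_distrib_left sum_distrib_right ..
    finally show ?thesis .
  qed
  then show ?thesis unfolding vec_eq_iff Q_def by blast
qed

text \<open>The i-th column of \<open>P\<close> is a unit eigenvector, and the quadratic form takes
  the value \<open>a i\<close> there. This applies to every diagonalization, as the uniqueness of
  powers below requires.\<close>

lemma positive_definite_diagonalization_pos:
  assumes "positive_definite (P ** real_diag a ** cadjoint P)" "unitary_matrix P"
  shows "a i > 0"
proof -
  define A where "A = P ** real_diag a ** cadjoint P"
  define e where "e = P *v axis i 1"
  have un: "cadjoint P ** P = mat 1" using assms by (simp add: unitary_matrix_def)
  have e_back: "cadjoint P *v e = axis i 1"
    by (simp add: e_def matrix_vector_mul_assoc un)
  then have "e \<noteq> 0" by auto
  then have "0 < (A *v e) \<bullet> e" using assms by (simp add: A_def positive_definite_def)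
  also have "(A *v e) \<bullet> e = Re (hinner (P *v (real_diag a *v (cadjoint P *v e))) e)"
    by (simp add: Re_hinner A_def matrix_vector_mul_assoc matrix_mul_assoc)
  also have "\<dots> = Re (hinner (real_diag a *v axis i 1) (axis i 1))"
    by (simp only: hinner_matrix_left[of P] e_back)
  also have "\<dots> = a i"
    by (simp add: hinner_def matrix_vector_mult_def real_diag_def axis_def mult_if_delta_complex
        if_distrib[of cnj] cong: if_cong)
  finally show ?thesis .
qed

text \<open>The intervals exhaust the open half-line but stay away from 0, where a negative power
  blows up. One index governs both the interval and the error, so the polynomials converge at every
  positive point.\<close>

lemma powr_polynomial_approx:
  "\<exists>c m. \<forall>t\<in>{1 / real (Suc k)..real (Suc k)}. \<bar>t powr s - (\<Sum>i\<le>m. c i * t ^ i)\<bar> < 1 / real (Suc k)"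
proof -
  have "continuous_on {1 / real (Suc k)..real (Suc k)} (\<lambda>t. t powr s)"
    by (intro continuous_intros) (auto simp: divide_le_eq)
  from Stone_Weierstrass_real_polynomial_function[OF compact_Icc this, of "1 / real (Suc k)"]
  obtain g where "real_polynomial_function g"
    and g: "\<And>t. t \<in> {1 / real (Suc k)..real (Suc k)} \<Longrightarrow> \<bar>t powr s - g t\<bar> < 1 / real (Suc k)"
    by auto
  then obtain c m where "g = (\<lambda>x. \<Sum>i\<le>m. c i * x ^ i)"
    by (auto simp: real_polynomial_function_iff_sum)
  with g show ?thesis by blast
qed

text \<open>The polynomials do not depend on the matrix, so powers are limits of polynomial maps.\<close>
lemma matrix_powr_limit_of_polynomials:
  obtains c m where
    "\<And>A :: complex^'n^'n. positive_definite A \<Longrightarrow> (\<lambda>k. mpoly (c k) (m k) A) \<longlonglongrightarrow> matrix_powr A s"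
proof -
  define Q where "Q = (\<lambda>k (c, m). \<forall>t\<in>{1 / real (Suc k)..real (Suc k)}.
      \<bar>t powr s - (\<Sum>i\<le>m. c i * t ^ i)\<bar> < 1 / real (Suc k))"
  have "\<forall>k. \<exists>cm. Q k cm" unfolding Q_def using powr_polynomial_approx[of _ s] by auto
  then obtain cm where cm: "\<And>k. Q k (cm k)" by metis
  define c m where "c k = fst (cm k)" and "m k = snd (cm k)" for k
  have approx: "\<bar>t powr s - (\<Sum>i\<le>m k. c k i * t ^ i)\<bar> < 1 / real (Suc k)"
    if "t \<in> {1 / real (Suc k)..real (Suc k)}" for k t
    using cm[of k] that by (auto simp: Q_def c_def m_def split: prod.splits)
  have scalar: "(\<lambda>k. \<Sum>i\<le>m k. c k i * t ^ i) \<longlonglongrightarrow> t powr s" if t: "t > 0" for t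
  proof -
    have "(\<lambda>k. (\<Sum>i\<le>m k. c k i * t ^ i) - t powr s) \<longlonglongrightarrow> 0"
    proof (rule Lim_null_comparison)
      have "\<forall>\<^sub>F k in sequentially. real (Suc k) \<ge> max t (1 / t)"
        using filterlim_real_sequentially
        by (simp add: filterlim_at_top filterlim_sequentially_Suc[symmetric, of real]
            eventually_sequentially_Suc[of "\<lambda>n. max t (1/t) \<le> real n"] del: of_nat_Suc max.bounded_iff)
      then show "\<forall>\<^sub>F k in sequentially. norm ((\<Sum>i\<le>m k. c k i * t ^ i) - t powr s) \<le> 1 / real (Suc k)"
      proof eventually_elim
        case (elim k)
        then have "t \<in> {1 / real (Suc k)..real (Suc k)}" using t
          by (auto simp: field_simps)
        from approx[OF this] show ?case by (simp add: abs_minus_commute)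
      qed
      show "(\<lambda>k. 1 / real (Suc k)) \<longlonglongrightarrow> 0"
        using LIMSEQ_inverse_real_of_nat by (simp add: inverse_eq_divide)
    qed
    then show ?thesis by (simp add: LIM_zero_iff)
  qed
  \<comment> \<open>The limit is computed along an arbitrary diagonalization of \<open>A\<close>,
    whereas the sequence depends on \<open>A\<close> alone.\<close>
  have lim: "(\<lambda>k. mpoly (c k) (m k) A) \<longlonglongrightarrow> P ** real_diag ((\<lambda>t. t powr s) \<circ> a) ** cadjoint P"
    if "positive_definite A" "unitary_matrix P" "A = P ** real_diag a ** cadjoint P"
    for A P :: "complex^'n^'n" and a
  proof (rule vec_tendstoI, rule vec_tendstoI)
    fix i j
    have "a r > 0" for r using that positive_definite_diagonalization_pos by blast
    from scalar[OF this]
    show "(\<lambda>k. mpoly (c k) (m k) A $ i $ j)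
      \<longlonglongrightarrow> (P ** real_diag ((\<lambda>t. t powr s) \<circ> a) ** cadjoint P) $ i $ j"
      unfolding that(3) mpoly_diagonalized[OF that(2)] conj_entry o_def
      by (intro tendsto_sum tendsto_mult tendsto_const tendsto_of_real)
  qed
  have "(\<lambda>k. mpoly (c k) (m k) A) \<longlonglongrightarrow> matrix_powr A s" if A: "positive_definite A"
    for A :: "complex^'n^'n"
  proof -
    obtain P a where Pa: "unitary_matrix P" "A = P ** real_diag a ** cadjoint P"
      using A spectral_theorem positive_definite_def by metis
    \<comment> \<open>Any two candidates for the definite description are limits of the same
      sequence, hence equal; this settles independence of the diagonalization without comparing
      eigenspaces.\<close>
    have "matrix_powr A s = P ** real_diag ((\<lambda>t. t powr s) \<circ> a) ** cadjoint P"
      unfolding matrix_powr_def spectral_calculus_def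
      using Pa lim[OF A] LIMSEQ_unique by (intro the_equality) blast+
    with lim[OF A Pa] show ?thesis by simp
  qed
  with that show ?thesis by blast
qed

section \<open>Measurability of matrix-valued functions\<close>

lemma borel_measurable_matrix_mult [measurable (raw)]:
  fixes f g :: "'a \<Rightarrow> complex^'n^'n"
  assumes "f \<in> borel_measurable M" "g \<in> borel_measurable M"
  shows "(\<lambda>x. f x ** g x) \<in> borel_measurable M"
proof -
  have "continuous_on UNIV (\<lambda>z :: (complex^'n^'n) \<times> (complex^'n^'n). fst z ** snd z)"
    unfolding matrix_matrix_mult_def
    by (intro continuous_on_vec_lambda continuous_on_sum continuous_on_mult
        continuous_on_component continuous_on_fst continuous_on_snd continuous_on_id)
  then show ?thesis by (rule borel_measurable_continuous_Pair[OF assms, where H="(**)"])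
qed

lemma borel_measurable_matrix_vector_mult [measurable (raw)]:
  fixes f :: "'a \<Rightarrow> complex^'n^'n"
  assumes "f \<in> borel_measurable M" "g \<in> borel_measurable M"
  shows "(\<lambda>x. f x *v g x) \<in> borel_measurable M"
proof -
  have "continuous_on UNIV (\<lambda>z :: (complex^'n^'n) \<times> (complex^'n). fst z *v snd z)"
    unfolding matrix_vector_mult_def
    by (intro continuous_on_vec_lambda continuous_on_sum continuous_on_mult
        continuous_on_component continuous_on_fst continuous_on_snd continuous_on_id)
  then show ?thesis by (rule borel_measurable_continuous_Pair[OF assms, where H="(*v)"])
qed

lemma borel_measurable_mpoly:
  assumes [measurable]: "f \<in> borel_measurable M"
  shows "(\<lambda>x. mpoly c m (f x)) \<in> borel_measurable M"
proof -
  have [measurable]: "(\<lambda>x. mpow (f x) k) \<in> borel_measurable M" for k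
    by (induction k) simp_all
  show ?thesis unfolding mpoly_def by measurable
qed

lemma borel_measurable_lebesgue_vecI:
  fixes f :: "real^'d \<Rightarrow> 'a::euclidean_space^'n"
  assumes "\<And>i. (\<lambda>x. f x $ i) \<in> borel_measurable lebesgue"
  shows "f \<in> borel_measurable lebesgue"
  unfolding borel_measurable_euclidean_space[of f]
proof
  fix b :: "'a^'n" assume "b \<in> Basis"
  have "(\<lambda>x. \<Sum>i\<in>UNIV. f x $ i \<bullet> b $ i) \<in> borel_measurable lebesgue"
    using assms by measurable
  then show "(\<lambda>x. f x \<bullet> b) \<in> borel_measurable lebesgue" by (simp add: inner_vec_def)
qed

text \<open>Local integrability gives measurability of the entries on each ball. The truncations to
  balls of radius k are eventually constant at every point, so their limit is measurable on the
  whole space.\<close>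

lemma borel_measurable_matrix_weight:
  fixes W :: "real^'d \<Rightarrow> complex^'n^'n"
  assumes "matrix_weight W"
  shows "W \<in> borel_measurable lebesgue"
proof (intro borel_measurable_lebesgue_vecI)
  fix i j
  show "(\<lambda>x. W x $ i $ j) \<in> borel_measurable lebesgue"
  proof (rule borel_measurable_LIMSEQ_metric)
    fix k :: nat
    have "(\<lambda>x. W x $ i $ j) absolutely_integrable_on cball 0 (real k)"
      using assms by (simp add: matrix_weight_def)
    then show "(\<lambda>x. indicator (cball 0 (real k)) x *\<^sub>R W x $ i $ j) \<in> borel_measurable lebesgue"
      by (simp add: set_integrable_def integrable_iff_bounded)
  next
    fix x :: "real^'d"
    have "\<forall>\<^sub>F k in sequentially. norm x \<le> real k"
      using filterlim_real_sequentially by (simp add: filterlim_at_top)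
    then show "(\<lambda>k. indicator (cball 0 (real k)) x *\<^sub>R W x $ i $ j) \<longlonglongrightarrow> W x $ i $ j"
      by (intro tendsto_eventually) (auto elim!: eventually_mono)
  qed
qed

text \<open>Where the weight fails to be positive definite, the polynomials may diverge and the
  power may be unrelated to them; this happens on a null set only, which Lebesgue measurability
  ignores by completeness.\<close>

theorem borel_measurable_matrix_powr:
  fixes W :: "real^'d \<Rightarrow> complex^'n^'n"
  assumes W: "matrix_weight W"
  shows "(\<lambda>x. matrix_powr (W x) s) \<in> borel_measurable lebesgue"
proof -
  have [measurable]: "W \<in> borel_measurable lebesgue"
    by (rule borel_measurable_matrix_weight[OF W])
  obtain c m where lim: "\<And>A :: complex^'n^'n. positive_definite A \<Longrightarrow>
      (\<lambda>k. mpoly (c k) (m k) A) \<longlonglongrightarrow> matrix_powr A s"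
    using matrix_powr_limit_of_polynomials by metis
  have "(\<lambda>x. lim (\<lambda>k. mpoly (c k) (m k) (W x))) \<in> borel_measurable lebesgue"
    by (intro borel_measurable_lim_metric borel_measurable_mpoly) measurable
  moreover have "AE x in lebesgue. positive_definite (W x)"
    using W by (simp add: matrix_weight_def)
  then have "AE x in lebesgue. lim (\<lambda>k. mpoly (c k) (m k) (W x)) = matrix_powr (W x) s"
    by eventually_elim (rule limI[OF lim])
  ultimately show ?thesis by (rule borel_measurable_AE)
qed

section \<open>The operator norm\<close>

lemma op_norm_nonneg: "0 \<le> op_norm A"
  by (simp add: op_norm_def onorm_pos_le bounded_linear_complex_matrix)

lemma norm_matrix_vector_le: "norm (A *v x) \<le> op_norm A * norm x"
  by (simp add: op_norm_def onorm bounded_linear_complex_matrix)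

lemma op_norm_mult_le: "op_norm (A ** B) \<le> op_norm A * op_norm B"
proof -
  have "(*v) (A ** B) = (*v) A \<circ> (*v) B"
    by (simp add: fun_eq_iff matrix_vector_mul_assoc)
  then show ?thesis
    by (simp add: op_norm_def onorm_compose bounded_linear_complex_matrix)
qed

text \<open>Reducing and testing estimates are available for one vector at a time. Through the
  columns they become estimates of the operator norm, at the price of a constant depending on the
  dimension.\<close>

lemma op_norm_le_columns: "op_norm A \<le> (\<Sum>i\<in>UNIV. norm (A *v axis i 1))"
proof -
  have "norm (A *v x) \<le> (\<Sum>i\<in>UNIV. norm (A *v axis i 1)) * norm x" for x
  proof -
    have eq: "A *v x = (\<Sum>i\<in>UNIV. x $ i *s (A *v axis i 1))"
      by (simp add: vec_eq_iff matrix_vector_mult_def axis_def mult_if_delta_complex mult.commute)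
    have nrm: "norm (c *s v) = norm c * norm v" for c and v :: "complex^'n"
      by (simp add: norm_vec_def L2_set_def norm_mult power_mult_distrib real_sqrt_mult
          flip: sum_distrib_left)
    have "norm (A *v x) \<le> (\<Sum>i\<in>UNIV. norm (x $ i) * norm (A *v axis i 1))"
      unfolding eq by (rule order_trans[OF norm_sum]) (simp add: nrm)
    also have "\<dots> \<le> (\<Sum>i\<in>UNIV. norm x * norm (A *v axis i 1))"
      by (intro sum_mono mult_right_mono Finite_Cartesian_Product.norm_nth_le) auto
    finally show ?thesis by (simp add: sum_distrib_right sum_distrib_left mult.commute)
  qed
  then show ?thesis unfolding op_norm_def by (intro onorm_bound sum_nonneg) auto
qed

text \<open>The operator norm is continuous: by the triangle inequality its increments are at most
  the norm of the difference, which the column bound sends to 0.\<close>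

lemma borel_measurable_op_norm [measurable (raw)]:
  assumes "f \<in> borel_measurable M"
  shows "(\<lambda>x. op_norm (f x)) \<in> borel_measurable M"
proof -
  have tri: "op_norm A \<le> op_norm B + op_norm (A - B)" for A B :: "complex^'n^'n"
  proof -
    have "op_norm (B + (A - B)) \<le> op_norm B + op_norm (A - B)"
      unfolding op_norm_def matrix_vector_mult_add_rdistrib
      by (intro onorm_triangle bounded_linear_complex_matrix)
    then show ?thesis by simp
  qed
  have sym: "op_norm (A - B) = op_norm (B - A)" for A B :: "complex^'n^'n"
  proof -
    have "(*v) (A - B) = (\<lambda>x. - ((B - A) *v x))"
      by (simp add: fun_eq_iff matrix_vector_mult_diff_rdistrib)
    then show ?thesis by (simp add: op_norm_def onorm_neg)
  qed
  have "continuous_on UNIV (op_norm :: complex^'n^'n \<Rightarrow> real)"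
    unfolding continuous_on_def
  proof (intro ballI)
    fix A :: "complex^'n^'n"
    have "((\<lambda>B. op_norm B - op_norm A) \<longlongrightarrow> 0) (at A)"
    proof (rule Lim_null_comparison)
      show "\<forall>\<^sub>F B in at A. norm (op_norm B - op_norm A) \<le> (\<Sum>i\<in>UNIV. norm ((B - A) *v axis i 1))"
      proof (intro always_eventually allI)
        fix B
        show "norm (op_norm B - op_norm A) \<le> (\<Sum>i\<in>UNIV. norm ((B - A) *v axis i 1))"
          using tri[of A B] tri[of B A] sym[of A B] op_norm_le_columns[of "B - A"] by simp
      qed
      have "((\<lambda>B. \<Sum>i\<in>UNIV. norm ((B - A) *v axis i 1)) \<longlongrightarrow> (\<Sum>i\<in>(UNIV::'n set). norm ((A - A) *v axis i 1))) (at A)"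
        unfolding matrix_vector_mult_def
        by (intro tendsto_intros)
      then show "((\<lambda>B. \<Sum>i\<in>UNIV. norm ((B - A) *v axis i 1)) \<longlongrightarrow> 0) (at A)" by simp
    qed
    then show "(op_norm \<longlongrightarrow> op_norm A) (at A within UNIV)" by (simp add: LIM_zero_iff)
  qed
  from borel_measurable_continuous_on[OF this assms] show ?thesis .
qed

section \<open>Powers of extended nonnegative reals and Hoelder's inequality\<close>

lemma epowr_ennreal: "0 \<le> r \<Longrightarrow> epowr (ennreal r) a = ennreal (r powr a)"
  by (simp add: epowr_def)

lemma epowr_top [simp]: "epowr top a = top"
  by (simp add: epowr_def)

lemma epowr_0 [simp]: "epowr 0 a = 0"
  by (simp add: epowr_def)

lemma epowr_1 [simp]: "epowr x 1 = x"
  by (cases x) (simp_all add: epowr_ennreal)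

lemma epowr_mono: "x \<le> y \<Longrightarrow> 0 \<le> a \<Longrightarrow> epowr x a \<le> epowr y a"
  by (cases x; cases y) (auto simp: epowr_ennreal powr_mono2 top_unique)

text \<open>There is no exceptional case, because \<open>epowr\<close> fixes 0 and
  \<open>top\<close> for every exponent and \<open>0 * top = 0\<close>. The same convention makes
  the addition law of exponents hold at 0 and \<open>top\<close>.\<close>

lemma epowr_mult: "epowr (x * y) a = epowr x a * epowr y a"
proof (cases x; cases y)
  fix r s :: real assume "0 \<le> r" "x = ennreal r" "0 \<le> s" "y = ennreal s"
  then show ?thesis by (simp add: epowr_ennreal powr_mult flip: ennreal_mult)
qed (auto simp: epowr_ennreal ennreal_mult_top ennreal_top_mult)

lemma epowr_epowr: "epowr (epowr x a) b = epowr x (a * b)"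
  by (cases x) (simp_all add: epowr_ennreal powr_powr)

lemma epowr_add: "epowr x (a + b) = epowr x a * epowr x b"
  by (cases x) (simp_all add: epowr_ennreal powr_add ennreal_mult)

lemma epowr_eq_0_iff [simp]: "epowr x a = 0 \<longleftrightarrow> x = 0"
  by (cases x) (auto simp: epowr_ennreal ennreal_eq_0_iff)

lemma epowr_eq_top_iff [simp]: "epowr x a = top \<longleftrightarrow> x = top"
  by (cases x) (auto simp: epowr_ennreal)

lemma epowr_less_top_iff [simp]: "epowr x a < top \<longleftrightarrow> x < top"
  by (simp flip: less_top)

lemma borel_measurable_epowr [measurable (raw)]:
  assumes [measurable]: "f \<in> borel_measurable M"
  shows "(\<lambda>x. epowr (f x) a) \<in> borel_measurable M"
  unfolding epowr_def by measurable

text \<open>Young's inequality for f / F^(1/p) and g / G^(1/q), multiplied back. With F and G the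
  integrals of the two powers, integration turns it directly into Hoelder's inequality. Real
  coefficients avoid division of extended reals.\<close>

lemma epowr_Young:
  assumes "1 < p" "1 < q" "1 / p + 1 / q = 1" and "0 < F" "0 < G"
  shows "f * g \<le> ennreal (F powr (1 / p) * G powr (1 / q) / (p * F)) * epowr f p
            + ennreal (F powr (1 / p) * G powr (1 / q) / (q * G)) * epowr g q"
proof (cases f; cases g)
  fix x y :: real assume x: "0 \<le> x" "f = ennreal x" and y: "0 \<le> y" "g = ennreal y"
  define a b where "a = F powr (1 / p)" and "b = G powr (1 / q)"
  have ab: "0 < a" "0 < b" "a powr p = F" "b powr q = G"
    using assms by (auto simp: a_def b_def powr_powr)
  have "x * y = a * b * ((x / a) * (y / b))" using ab by simp
  also have "\<dots> \<le> a * b * ((x / a) powr p / p + (y / b) powr q / q)"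
    using ab x y assms by (intro mult_left_mono Youngs_inequality) auto
  also have "\<dots> = a * b / (p * F) * x powr p + a * b / (q * G) * y powr q"
    using ab x y by (simp add: powr_divide algebra_simps)
  finally have "x * y \<le> a * b / (p * F) * x powr p + a * b / (q * G) * y powr q" .
  then show ?thesis
    using x y ab assms by (simp add: epowr_ennreal flip: ennreal_mult ennreal_plus a_def b_def)
qed (use assms in \<open>auto simp: ennreal_mult_top ennreal_top_mult\<close>)

theorem nn_integral_Holder:
  assumes pq: "1 < p" "1 < q" "1 / p + 1 / q = 1"
    and [measurable]: "f \<in> borel_measurable M" "g \<in> borel_measurable M"
  shows "(\<integral>\<^sup>+x. f x * g x \<partial>M) \<le> epowr (\<integral>\<^sup>+x. epowr (f x) p \<partial>M) (1 / p) *
           epowr (\<integral>\<^sup>+x. epowr (g x) q \<partial>M) (1 / q)"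
proof -
  define F G where "F = (\<integral>\<^sup>+x. epowr (f x) p \<partial>M)" and "G = (\<integral>\<^sup>+x. epowr (g x) q \<partial>M)"
  \<comment> \<open>The normalization needs both integrals in the open interval from 0 to infinity.
    Vanishing is separated before infinity: if one integral is 0 and the other infinite, both sides
    are 0.\<close>
  consider "F = 0" | "G = 0" | "F \<noteq> 0" "G \<noteq> 0" "F = top \<or> G = top"
    | r s where "0 < r" "F = ennreal r" "0 < s" "G = ennreal s"
    by (cases F; cases G) (auto simp: less_le)
  then show ?thesis
  proof cases
    case 1
    then have "AE x in M. f x = 0" unfolding F_def by (subst (asm) nn_integral_0_iff_AE) auto
    then have "(\<integral>\<^sup>+x. f x * g x \<partial>M) = 0"
      by (subst nn_integral_0_iff_AE) (auto elim: eventually_mono)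
    then show ?thesis by simp
  next
    case 2
    then have "AE x in M. g x = 0" unfolding G_def by (subst (asm) nn_integral_0_iff_AE) auto
    then have "(\<integral>\<^sup>+x. f x * g x \<partial>M) = 0"
      by (subst nn_integral_0_iff_AE) (auto elim: eventually_mono)
    then show ?thesis by simp
  next
    case 3
    then have "epowr F (1 / p) * epowr G (1 / q) = top"
      by (auto simp: ennreal_mult_top ennreal_top_mult)
    then show ?thesis by (simp add: F_def G_def)
  next
    case 4
    define c where "c = r powr (1 / p) * s powr (1 / q)"
    have "(\<integral>\<^sup>+x. f x * g x \<partial>M) \<le>
        (\<integral>\<^sup>+x. ennreal (c / (p * r)) * epowr (f x) p + ennreal (c / (q * s)) * epowr (g x) q \<partial>M)"
      unfolding c_def using pq 4 by (intro nn_integral_mono epowr_Young)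
    also have "\<dots> = ennreal (c / (p * r)) * F + ennreal (c / (q * s)) * G"
      by (simp add: nn_integral_add nn_integral_cmult F_def G_def)
    also have "\<dots> = ennreal (c / (p * r) * r + c / (q * s) * s)"
      using 4 pq by (simp add: c_def flip: ennreal_mult ennreal_plus)
    also have "c / (p * r) * r + c / (q * s) * s = c * (1 / p + 1 / q)"
      using 4 by (simp add: field_simps)
    also have "ennreal \<dots> = epowr F (1 / p) * epowr G (1 / q)"
      using 4 pq(3) by (simp add: c_def epowr_ennreal ennreal_mult)
    finally show ?thesis by (simp add: F_def G_def)
  qed
qed

section \<open>Covering by cubes\<close>

lemma mem_cube: "x \<in> cube c l \<longleftrightarrow> (\<forall>i. \<bar>x $ i - c $ i\<bar> < l / 2)"
  unfolding cube_def mem_box_cart abs_less_iff by (rule all_cong1) auto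

lemma open_cube: "open (cube c l)"
  by (simp add: cube_def open_box)

lemma sets_cube [measurable, simp]: "cube c l \<in> sets lebesgue"
  by (simp add: cube_def)

lemma emeasure_cube:
  fixes c :: "real^'d"
  assumes "0 < l"
  shows "emeasure lebesgue (cube c l) = ennreal (l ^ CARD('d))"
proof -
  have "emeasure lebesgue (cube c l) = ennreal (\<Prod>b\<in>Basis. (c + vec (l / 2) - (c - vec (l / 2))) \<bullet> (b :: real^'d))"
    unfolding cube_def using assms
    by (simp del: emeasure_lborel_box, subst emeasure_lborel_box) (auto simp: inner_diff_left inner_add_left Basis_vec_def inner_axis)
  also have "(\<Prod>b\<in>Basis. (c + vec (l / 2) - (c - vec (l / 2))) \<bullet> (b :: real^'d)) = (\<Prod>b\<in>(Basis :: (real^'d) set). l)"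
    by (intro prod.cong refl) (auto simp: inner_diff_left inner_add_left Basis_vec_def inner_axis)
  finally show ?thesis by simp
qed

lemma vol_eq: "0 < l \<Longrightarrow> vol (c :: real^'d) l = l ^ CARD('d)"
  unfolding vol_def measure_def by (simp only: emeasure_cube) simp

lemma vol_pos: "0 < l \<Longrightarrow> 0 < vol c l"
  by (simp add: vol_eq)

lemma emeasure_cube_vol: "0 < l \<Longrightarrow> emeasure lebesgue (cube c l) = ennreal (vol c l)"
  by (simp only: vol_eq emeasure_cube)

lemma cube_subset_ball:
  fixes c :: "real^'d"
  assumes "0 < l"
  shows "cube c l \<subseteq> ball c (l * real CARD('d))"
proof
  fix x assume "x \<in> cube c l"
  then have x: "\<bar>(x - c) $ i\<bar> < l / 2" for i by (simp add: mem_cube)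
  have "norm (x - c) \<le> (\<Sum>i\<in>UNIV. \<bar>(x - c) $ i\<bar>)" by (rule norm_le_l1_cart)
  also have "\<dots> \<le> (\<Sum>i\<in>(UNIV :: 'd set). l / 2)" by (rule sum_mono) (use x less_imp_le in blast)
  also have "\<dots> < l * real CARD('d)" using assms by simp
  finally show "x \<in> ball c (l * real CARD('d))" by (simp add: dist_norm norm_minus_commute)
qed

lemma ball_subset_cube: "ball c r \<subseteq> cube c (2 * r)"
proof
  fix x assume "x \<in> ball c r"
  then have "norm (x - c) < r" by (simp add: dist_norm norm_minus_commute)
  then have "\<bar>(x - c) $ i\<bar> < r" for i
    using component_le_norm_cart[of "x - c" i] by simp
  then show "x \<in> cube c (2 * r)" by (simp add: mem_cube)
qed

text \<open>The ball of radius l d about the center contains the cube of side l, so disjoint balls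
  yield disjoint cubes. Vitali enlarges radii five times, and the ball of radius 5 l d lies in the
  concentric cube of side 10 d l, whence the factor. The common bound \<open>B\<close> on the
  side-lengths is what the covering lemma for balls asks for.\<close>

lemma Vitali_covering_cubes:
  fixes S :: "((real^'d) \<times> real) set"
  assumes S: "\<And>c l. (c, l) \<in> S \<Longrightarrow> 0 < l \<and> l \<le> B"
  obtains T where "countable T" "T \<subseteq> S"
    "disjoint_family_on (\<lambda>(c, l). cube c l) T"
    "(\<Union>(c, l)\<in>S. cube c l) \<subseteq> (\<Union>(c, l)\<in>T. cube c (10 * real CARD('d) * l))"
proof -
  define r :: "(real^'d) \<times> real \<Rightarrow> real" where "r z = snd z * real CARD('d)" for z
  have r: "0 < r z \<and> r z \<le> B * real CARD('d)" if "z \<in> S" for z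
    using S[of "fst z" "snd z"] that by (auto simp: r_def)
  obtain T where T: "countable T" "T \<subseteq> S"
    "pairwise (\<lambda>i j. disjnt (ball (fst i) (r i)) (ball (fst j) (r j))) T"
    "(\<Union>i\<in>S. ball (fst i) (r i)) \<subseteq> (\<Union>i\<in>T. ball (fst i) (5 * r i))"
    by (rule Vitali_covering_lemma_balls[OF order_refl r])
  have sub: "cube (fst z) (snd z) \<subseteq> ball (fst z) (r z)" if "z \<in> S" for z
    using S[of "fst z" "snd z"] that cube_subset_ball by (auto simp: r_def)
  have "disjoint_family_on (\<lambda>(c, l). cube c l) T"
    unfolding disjoint_family_on_def case_prod_beta
  proof (intro ballI impI)
    fix i j assume ij: "i \<in> T" "j \<in> T" "i \<noteq> j"
    then have "disjnt (ball (fst i) (r i)) (ball (fst j) (r j))"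
      using T(3) by (simp add: pairwise_def)
    moreover have "i \<in> S" "j \<in> S" using ij T(2) by auto
    ultimately show "cube (fst i) (snd i) \<inter> cube (fst j) (snd j) = {}"
      using sub[of i] sub[of j] by (auto simp: disjnt_def)
  qed
  moreover have "(\<Union>(c, l)\<in>S. cube c l) \<subseteq> (\<Union>(c, l)\<in>T. cube c (10 * real CARD('d) * l))"
  proof -
    have "(\<Union>(c, l)\<in>S. cube c l) \<subseteq> (\<Union>i\<in>S. ball (fst i) (r i))" using sub by fastforce
    also have "\<dots> \<subseteq> (\<Union>i\<in>T. ball (fst i) (5 * r i))" by (rule T(4))
    also have "\<dots> \<subseteq> (\<Union>(c, l)\<in>T. cube c (10 * real CARD('d) * l))"
      using ball_subset_cube by (fastforce simp: r_def mult_ac)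
    finally show ?thesis .
  qed
  ultimately show ?thesis using that T by blast
qed

text \<open>Countable subadditivity written as an integral against counting measure, so that the
  selected cubes need no enumeration and the sum can be treated by the rules for integrals.\<close>

lemma emeasure_UN_countable_le:
  assumes "countable I" and [measurable]: "\<And>i. i \<in> I \<Longrightarrow> X i \<in> sets M"
  shows "emeasure M (\<Union>i\<in>I. X i) \<le> (\<integral>\<^sup>+i. emeasure M (X i) \<partial>count_space I)"
proof -
  have U: "(\<Union>i\<in>I. X i) \<in> sets M" using assms by (intro sets.countable_UN') auto
  have "emeasure M (\<Union>i\<in>I. X i) = (\<integral>\<^sup>+x. indicator (\<Union>i\<in>I. X i) x \<partial>M)" using U by simp
  also have "\<dots> \<le> (\<integral>\<^sup>+x. (\<integral>\<^sup>+i. indicator (X i) x \<partial>count_space I) \<partial>M)"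
  proof (rule nn_integral_mono)
    fix x
    show "indicator (\<Union>i\<in>I. X i) x \<le> (\<integral>\<^sup>+i. indicator (X i) x \<partial>count_space I)"
    proof (cases "x \<in> (\<Union>i\<in>I. X i)")
      case True
      then obtain i where i: "i \<in> I" "x \<in> X i" by blast
      then have "indicator (X i) x \<le> (\<integral>\<^sup>+i. indicator (X i) x \<partial>count_space I :: ennreal)"
        by (intro nn_integral_ge_point)
      with i show ?thesis by (auto simp: indicator_def)
    qed simp
  qed
  also have "\<dots> = (\<integral>\<^sup>+i. (\<integral>\<^sup>+x. indicator (X i) x \<partial>M) \<partial>count_space I)"
    using assms by (intro nn_integral_count_space_nn_integral) auto
  also have "\<dots> = (\<integral>\<^sup>+i. emeasure M (X i) \<partial>count_space I)"
    by (intro nn_integral_cong) simp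
  finally show ?thesis .
qed

text \<open>The weak-type principle: \<open>r \<ge> 1\<close> makes \<open>A \<mapsto> \<mu>(A)\<^sup>r\<close> superadditive over the
  disjoint cubes that the covering lemma selects.\<close>
lemma emeasure_UN_cubes_le:
  fixes S :: "((real^'d) \<times> real) set"
  assumes [measurable]: "g \<in> borel_measurable lebesgue"
    and M: "(\<integral>\<^sup>+x. g x \<partial>lebesgue) < top" and K: "K < top" and r: "1 \<le> r"
    and S: "\<And>c l. (c, l) \<in> S \<Longrightarrow> 0 < l \<and>
        ennreal (vol c l) \<le> K * epowr (\<integral>\<^sup>+x\<in>cube c l. g x \<partial>lebesgue) r"
  shows "emeasure lebesgue (\<Union>(c, l)\<in>S. cube c l) \<le>
    ennreal ((10 * real CARD('d)) ^ CARD('d)) * (K * epowr (\<integral>\<^sup>+x. g x \<partial>lebesgue) r)"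
proof -
  define \<mu> where "\<mu> = density lebesgue g"
  have mu: "(\<integral>\<^sup>+x\<in>cube c l. g x \<partial>lebesgue) = emeasure \<mu> (cube c l)" for c l
    by (simp add: \<mu>_def emeasure_density)
  have mtot: "(\<integral>\<^sup>+x. g x \<partial>lebesgue) = emeasure \<mu> UNIV"
    using emeasure_density[of g lebesgue UNIV] by (simp add: \<mu>_def)
  have sets_mu [measurable_cong]: "sets \<mu> = sets lebesgue" by (simp add: \<mu>_def)
  define H where "H = K * epowr (emeasure \<mu> UNIV) r"
  have H: "H < top" using K M by (simp add: H_def mtot ennreal_mult_less_top)
  have le_tot: "emeasure \<mu> A \<le> emeasure \<mu> UNIV" for A
    by (intro emeasure_mono) (simp_all add: sets_mu)
  \<comment> \<open>The side-lengths have to be bounded before Vitali applies. The hypothesis bounds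
    every volume by the finite number \<open>H\<close>, and l is at most its d-th power once it is
    at least 1.\<close>
  have bnd: "0 < l \<and> l \<le> max 1 (enn2real H)" if cl: "(c, l) \<in> S" for c l
  proof -
    have "ennreal (vol c l) \<le> K * epowr (emeasure \<mu> (cube c l)) r"
      using S[OF cl] by (simp add: mu)
    also have "\<dots> \<le> H" unfolding H_def using r by (intro mult_left_mono epowr_mono le_tot) auto
    finally have "vol c l \<le> enn2real H" using H
      by (metis enn2real_ennreal enn2real_mono measure_nonneg vol_def)
    moreover have "l \<le> l ^ CARD('d)" if "1 \<le> l"
      using that power_increasing[of 1 "CARD('d)" l] by simp
    ultimately show ?thesis using S[OF cl] by (cases "1 \<le> l") (auto simp: vol_eq)
  qed
  obtain T where T: "countable T" "T \<subseteq> S"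
    "disjoint_family_on (\<lambda>(c, l). cube c l) T"
    "(\<Union>(c, l)\<in>S. cube c l) \<subseteq> (\<Union>(c, l)\<in>T. cube c (10 * real CARD('d) * l))"
    by (rule Vitali_covering_cubes[OF bnd])
  define D where "D = (10 * real CARD('d)) ^ CARD('d)"
  have Dl: "emeasure lebesgue (cube c (10 * real CARD('d) * l)) = ennreal D * ennreal (vol c l)"
    if "(c, l) \<in> T" for c l
  proof -
    have "0 < l" using that T(2) S by blast
    then have "emeasure lebesgue (cube c (10 * real CARD('d) * l)) =
        ennreal ((10 * real CARD('d) * l) ^ CARD('d))"
      by (intro emeasure_cube) simp
    also have "\<dots> = ennreal D * ennreal (vol c l)"
      using \<open>0 < l\<close> by (simp add: vol_eq D_def power_mult_distrib flip: ennreal_mult)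
    finally show ?thesis .
  qed
  \<comment> \<open>One factor of the mass is kept, to be summed over the disjoint cubes; the
    remaining power, with exponent r - 1 \<ge> 0, is estimated by the total mass.\<close>
  have split: "epowr z r = z * epowr z (r - 1)" for z
    using epowr_add[of z 1 "r - 1"] by simp
  have "emeasure lebesgue (\<Union>(c, l)\<in>S. cube c l) \<le>
      emeasure lebesgue (\<Union>(c, l)\<in>T. cube c (10 * real CARD('d) * l))"
    by (rule emeasure_mono[OF T(4)]) (use T(1) in \<open>auto intro!: sets.countable_UN'\<close>)
  also have "\<dots> \<le> (\<integral>\<^sup>+z. emeasure lebesgue (case z of (c, l) \<Rightarrow> cube c (10 * real CARD('d) * l)) \<partial>count_space T)"
    using T(1) by (intro emeasure_UN_countable_le) auto
  also have "\<dots> \<le> (\<integral>\<^sup>+z. ennreal D * (K * epowr (emeasure \<mu> UNIV) (r - 1)) *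
      emeasure \<mu> (case z of (c, l) \<Rightarrow> cube c l) \<partial>count_space T)"
  proof (rule nn_integral_mono)
    fix z assume "z \<in> space (count_space T)"
    then obtain c l where z: "z = (c, l)" "(c, l) \<in> T" by (cases z) auto
    have "ennreal (vol c l) \<le> K * epowr (emeasure \<mu> (cube c l)) r"
      using S[of c l] z T(2) by (auto simp: mu)
    also have "\<dots> \<le> K * (emeasure \<mu> (cube c l) * epowr (emeasure \<mu> UNIV) (r - 1))"
      unfolding split using r by (intro mult_left_mono epowr_mono le_tot) auto
    finally have "ennreal D * ennreal (vol c l) \<le>
        ennreal D * (K * (emeasure \<mu> (cube c l) * epowr (emeasure \<mu> UNIV) (r - 1)))"
      by (rule mult_left_mono) simp
    then show "emeasure lebesgue (case z of (c, l) \<Rightarrow> cube c (10 * real CARD('d) * l)) \<le>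
        ennreal D * (K * epowr (emeasure \<mu> UNIV) (r - 1)) * emeasure \<mu> (case z of (c, l) \<Rightarrow> cube c l)"
      unfolding z(1) prod.case Dl[OF z(2)] by (simp only: mult_ac)
  qed
  also have "\<dots> = ennreal D * (K * epowr (emeasure \<mu> UNIV) (r - 1)) *
      (\<integral>\<^sup>+z. emeasure \<mu> (case z of (c, l) \<Rightarrow> cube c l) \<partial>count_space T)"
    by (rule nn_integral_cmult) simp
  also have "(\<integral>\<^sup>+z. emeasure \<mu> (case z of (c, l) \<Rightarrow> cube c l) \<partial>count_space T) =
      emeasure \<mu> (\<Union>(c, l)\<in>T. cube c l)"
    using T(1,3) by (intro emeasure_UN_countable[symmetric]) (auto simp: sets_mu)
  also have "ennreal D * (K * epowr (emeasure \<mu> UNIV) (r - 1)) * emeasure \<mu> (\<Union>(c, l)\<in>T. cube c l) \<le>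
      ennreal D * (K * epowr (emeasure \<mu> UNIV) (r - 1)) * emeasure \<mu> UNIV"
    by (intro mult_left_mono le_tot) auto
  also have "\<dots> = ennreal D * (K * epowr (emeasure \<mu> UNIV) r)"
    by (simp add: split[of "emeasure \<mu> UNIV"] mult_ac)
  finally show ?thesis by (simp add: D_def mtot)
qed

section \<open>Matrix-weighted averages over a finite measure space\<close>

text \<open>Tonelli for the kernel that appears in the two-weight constants: the inner integral is
  measurable in the remaining variable, in either order, so constants can be pulled out of the outer
  one.\<close>

lemma (in sigma_finite_measure) borel_measurable_kernel:
  fixes u v :: "'a \<Rightarrow> complex^'n^'n"
  assumes [measurable]: "u \<in> borel_measurable M" "v \<in> borel_measurable M"
  shows "(\<lambda>x. \<integral>\<^sup>+y. ennreal (op_norm (u x ** v y) powr s) \<partial>M) \<in> borel_measurable M"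
    and "(\<lambda>y. \<integral>\<^sup>+x. ennreal (op_norm (u x ** v y) powr s) \<partial>M) \<in> borel_measurable M"
  by measurable

text \<open>Linearity replaces Minkowski's inequality, which points the wrong way: a component of
  \<open>\<integral> R (v f)\<close> with absolute values is \<open>R w\<close> for a vector integral \<open>w\<close> of \<open>\<plusminus>v f\<close>,
  and the reducing property is then applied to the single vector \<open>w\<close>.\<close>
lemma (in finite_measure) reduced_component_le:
  fixes u v :: "'a \<Rightarrow> complex^'n^'n" and f :: "'a \<Rightarrow> complex^'n" and R :: "complex^'n^'n"
  assumes pp: "1 < p" "p' = p / (p - 1)" and q: "0 < q"
    and [measurable]: "u \<in> borel_measurable M" "v \<in> borel_measurable M" "f \<in> borel_measurable M"
    and R: "\<And>e. ennreal (norm (R *v e)) \<le>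
      K * epowr (\<kappa> * (\<integral>\<^sup>+x. ennreal (norm (u x *v e) powr q) \<partial>M)) (1 / q)"
  shows "(\<integral>\<^sup>+y. ennreal \<bar>(R *v (v y *v f y)) \<bullet> b\<bar> \<partial>M) \<le> ennreal (norm b) *
     (K * epowr (\<kappa> * (\<integral>\<^sup>+x. epowr (\<integral>\<^sup>+y. ennreal (op_norm (u x ** v y) powr p') \<partial>M) (q / p') \<partial>M)) (1 / q)
      * epowr (\<integral>\<^sup>+y. ennreal (norm (f y) powr p) \<partial>M) (1 / p))" (is "_ \<le> ?rhs")
proof -
  have p': "1 < p'" "1 / p' + 1 / p = 1"
    using pp by (simp_all add: less_divide_eq diff_divide_distrib)
  define F where "F y = (R *v (v y *v f y)) \<bullet> b" for y
  \<comment> \<open>The integrand \<open>v f\<close> need not be integrable. On \<open>E k\<close>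
    it is bounded, and the measure is finite, so its vector integral exists there; the sets increase
    to the whole space.\<close>
  define E where "E k = {y \<in> space M. norm (v y *v f y) \<le> real k}" for k :: nat
  define J where "J x = (\<integral>\<^sup>+y. ennreal (op_norm (u x ** v y) powr p') \<partial>M)" for x
  define L where "L = (\<integral>\<^sup>+y. ennreal (norm (f y) powr p) \<partial>M)"
  have [measurable]: "E k \<in> sets M" for k unfolding E_def by measurable
  have [measurable]: "F \<in> borel_measurable M" unfolding F_def by measurable
  have [measurable]: "J \<in> borel_measurable M"
    unfolding J_def by (intro borel_measurable_kernel) measurable
  have part: "(\<integral>\<^sup>+y. ennreal \<bar>F y\<bar> * indicator (E k) y \<partial>M) \<le> ?rhs" for k
  proof -
    \<comment> \<open>The sign is chosen for the fixed component \<open>b\<close>: the linear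
      functional then maps the vector integral \<open>w\<close> to the integral of the absolute
      value of that component.\<close>
    define h where "h y = sgn (F y) * indicator (E k) y" for y
    have [measurable]: "h \<in> borel_measurable M" unfolding h_def by measurable
    have hle: "\<bar>h y\<bar> \<le> 1" for y by (auto simp: h_def abs_mult indicator_def sgn_if)
    have hint: "integrable M (\<lambda>y. h y *\<^sub>R (v y *v f y))"
    proof (rule integrable_const_bound[of _ "real k"])
      show "AE y in M. norm (h y *\<^sub>R (v y *v f y)) \<le> real k"
        by (rule AE_I2) (auto simp: h_def E_def indicator_def sgn_if)
    qed measurable
    define w where "w = (\<integral>y. h y *\<^sub>R (v y *v f y) \<partial>M)"
    have blR: "bounded_linear (\<lambda>z. (R *v z) \<bullet> b)"
      by (intro bounded_linear_intros bounded_linear_compose[OF bounded_linear_inner_left bounded_linear_complex_matrix])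
    have "(R *v w) \<bullet> b = (\<integral>y. (R *v (h y *\<^sub>R (v y *v f y))) \<bullet> b \<partial>M)"
      unfolding w_def by (rule integral_bounded_linear[OF blR hint, symmetric])
    also have "\<dots> = (\<integral>y. \<bar>F y\<bar> * indicator (E k) y \<partial>M)"
      by (intro Bochner_Integration.integral_cong refl)
        (auto simp: matrix_mult_scaleR h_def F_def indicator_def sgn_if)
    finally have Rw: "(R *v w) \<bullet> b = (\<integral>y. \<bar>F y\<bar> * indicator (E k) y \<partial>M)" .
    have int: "integrable M (\<lambda>y. \<bar>F y\<bar> * indicator (E k) y)"
    proof -
      have "integrable M (\<lambda>y. (R *v (h y *\<^sub>R (v y *v f y))) \<bullet> b)"
        by (rule integrable_bounded_linear[OF blR hint])
      also have "(\<lambda>y. (R *v (h y *\<^sub>R (v y *v f y))) \<bullet> b) = (\<lambda>y. \<bar>F y\<bar> * indicator (E k) y)"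
        by (auto simp: matrix_mult_scaleR h_def F_def indicator_def sgn_if)
      finally show ?thesis .
    qed
    have "(\<integral>\<^sup>+y. ennreal \<bar>F y\<bar> * indicator (E k) y \<partial>M) = (\<integral>\<^sup>+y. ennreal (\<bar>F y\<bar> * indicator (E k) y) \<partial>M)"
      by (intro nn_integral_cong) (auto simp: indicator_def)
    also have "\<dots> = ennreal ((R *v w) \<bullet> b)"
      unfolding Rw by (rule nn_integral_eq_integral[OF int]) auto
    also have "\<dots> \<le> ennreal (norm b * norm (R *v w))"
      by (rule ennreal_leI) (metis mult.commute norm_cauchy_schwarz)
    also have "\<dots> = ennreal (norm b) * ennreal (norm (R *v w))"
      by (simp add: ennreal_mult)
    also have "\<dots> \<le> ?rhs"
    proof (rule mult_left_mono)
      \<comment> \<open>The matrix \<open>u x\<close> also passes under the integral defining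
        \<open>w\<close>; only then are norms taken, and Hoelder in y produces the inner L^p' norm
        of the class for this fixed x.\<close>
      have uw: "ennreal (norm (u x *v w)) \<le> epowr (J x) (1 / p') * epowr L (1 / p)" for x
      proof -
        have "u x *v w = (\<integral>y. u x *v (h y *\<^sub>R (v y *v f y)) \<partial>M)"
          unfolding w_def
          by (rule integral_bounded_linear[OF bounded_linear_complex_matrix hint, symmetric])
        then have "ennreal (norm (u x *v w)) \<le> (\<integral>\<^sup>+y. norm (u x *v (h y *\<^sub>R (v y *v f y))) \<partial>M)"
          using integral_norm_bound_ennreal[OF integrable_bounded_linear[OF bounded_linear_complex_matrix hint], of "u x"]
          by simp
        also have "\<dots> \<le> (\<integral>\<^sup>+y. ennreal (op_norm (u x ** v y)) * ennreal (norm (f y)) \<partial>M)"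
        proof (intro nn_integral_mono)
          fix y
          have "norm (u x *v (h y *\<^sub>R (v y *v f y))) = \<bar>h y\<bar> * norm ((u x ** v y) *v f y)"
            by (simp add: matrix_mult_scaleR matrix_vector_mul_assoc)
          also have "\<dots> \<le> 1 * (op_norm (u x ** v y) * norm (f y))"
            by (intro mult_mono hle norm_matrix_vector_le) auto
          finally show "ennreal (norm (u x *v (h y *\<^sub>R (v y *v f y)))) \<le>
              ennreal (op_norm (u x ** v y)) * ennreal (norm (f y))"
            by (simp add: op_norm_nonneg flip: ennreal_mult)
        qed
        also have "\<dots> \<le> epowr (\<integral>\<^sup>+y. epowr (ennreal (op_norm (u x ** v y))) p' \<partial>M) (1 / p') *
            epowr (\<integral>\<^sup>+y. epowr (ennreal (norm (f y))) p \<partial>M) (1 / p)"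
          using p' pp by (intro nn_integral_Holder) measurable
        finally show ?thesis by (simp add: epowr_ennreal op_norm_nonneg J_def L_def)
      qed
      have "(\<integral>\<^sup>+x. ennreal (norm (u x *v w) powr q) \<partial>M) \<le>
          (\<integral>\<^sup>+x. epowr (J x) (q / p') * epowr L (q / p) \<partial>M)"
      proof (intro nn_integral_mono)
        fix x
        have "ennreal (norm (u x *v w) powr q) = epowr (ennreal (norm (u x *v w))) q"
          by (simp add: epowr_ennreal)
        also have "\<dots> \<le> epowr (epowr (J x) (1 / p') * epowr L (1 / p)) q"
          using q uw by (intro epowr_mono) auto
        finally show "ennreal (norm (u x *v w) powr q) \<le> epowr (J x) (q / p') * epowr L (q / p)"
          by (simp add: epowr_mult epowr_epowr)
      qed
      also have "\<dots> = (\<integral>\<^sup>+x. epowr (J x) (q / p') \<partial>M) * epowr L (q / p)"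
        by (intro nn_integral_multc) measurable
      finally have le: "(\<integral>\<^sup>+x. ennreal (norm (u x *v w) powr q) \<partial>M) \<le> \<dots>" .
      have "ennreal (norm (R *v w)) \<le>
          K * epowr (\<kappa> * (\<integral>\<^sup>+x. ennreal (norm (u x *v w) powr q) \<partial>M)) (1 / q)" by (rule R)
      also have "\<dots> \<le> K * epowr (\<kappa> * ((\<integral>\<^sup>+x. epowr (J x) (q / p') \<partial>M) * epowr L (q / p))) (1 / q)"
        using q le by (intro mult_left_mono epowr_mono) auto
      also have "\<dots> = K * epowr (\<kappa> * (\<integral>\<^sup>+x. epowr (J x) (q / p') \<partial>M)) (1 / q) * epowr L (1 / p)"
        using q by (simp add: epowr_mult epowr_epowr mult.assoc)
      finally show "ennreal (norm (R *v w)) \<le> K * epowr (\<kappa> *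
         (\<integral>\<^sup>+x. epowr (\<integral>\<^sup>+y. ennreal (op_norm (u x ** v y) powr p') \<partial>M) (q / p') \<partial>M)) (1 / q) *
         epowr (\<integral>\<^sup>+y. ennreal (norm (f y) powr p) \<partial>M) (1 / p)"
        by (simp add: J_def L_def)
    qed simp
    finally show ?thesis .
  qed
  have "(\<integral>\<^sup>+y. ennreal \<bar>F y\<bar> \<partial>M) = (\<integral>\<^sup>+y. (SUP k. ennreal \<bar>F y\<bar> * indicator (E k) y) \<partial>M)"
  proof (intro nn_integral_cong)
    fix y assume y: "y \<in> space M"
    obtain k where "norm (v y *v f y) \<le> real k" using real_arch_simple by blast
    then have "ennreal \<bar>F y\<bar> \<le> (SUP k. ennreal \<bar>F y\<bar> * indicator (E k) y)"
      using y by (intro SUP_upper2[of k]) (auto simp: E_def)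
    moreover have "(SUP k. ennreal \<bar>F y\<bar> * indicator (E k) y) \<le> ennreal \<bar>F y\<bar>"
      by (intro SUP_least) (auto simp: indicator_def)
    ultimately show "ennreal \<bar>F y\<bar> = (SUP k. ennreal \<bar>F y\<bar> * indicator (E k) y)"
      by (rule antisym)
  qed
  also have "\<dots> = (SUP k. \<integral>\<^sup>+y. ennreal \<bar>F y\<bar> * indicator (E k) y \<partial>M)"
  proof (intro nn_integral_monotone_convergence_SUP)
    show "incseq (\<lambda>k y. ennreal \<bar>F y\<bar> * indicator (E k) y)"
      by (auto simp: incseq_def le_fun_def E_def indicator_def)
  qed measurable
  also have "\<dots> \<le> ?rhs" by (intro SUP_least part)
  finally show ?thesis by (simp add: F_def)
qed

text \<open>The norm is at most the sum of the absolute components over the real basis, which has 2n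
  elements; each component obeys the preceding bound.\<close>

lemma (in finite_measure) reduced_integral_le:
  fixes u v :: "'a \<Rightarrow> complex^'n^'n" and f :: "'a \<Rightarrow> complex^'n" and R :: "complex^'n^'n"
  assumes pp: "1 < p" "p' = p / (p - 1)" and q: "0 < q"
    and [measurable]: "u \<in> borel_measurable M" "v \<in> borel_measurable M" "f \<in> borel_measurable M"
    and R: "\<And>e. ennreal (norm (R *v e)) \<le>
      K * epowr (\<kappa> * (\<integral>\<^sup>+x. ennreal (norm (u x *v e) powr q) \<partial>M)) (1 / q)"
  shows "(\<integral>\<^sup>+y. ennreal (norm (R *v (v y *v f y))) \<partial>M) \<le> ennreal (real DIM(complex^'n)) *
     (K * epowr (\<kappa> * (\<integral>\<^sup>+x. epowr (\<integral>\<^sup>+y. ennreal (op_norm (u x ** v y) powr p') \<partial>M) (q / p') \<partial>M)) (1 / q)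
      * epowr (\<integral>\<^sup>+y. ennreal (norm (f y) powr p) \<partial>M) (1 / p))" (is "_ \<le> _ * ?N")
proof -
  have meas: "(\<lambda>y. ennreal \<bar>(R *v (v y *v f y)) \<bullet> b\<bar>) \<in> borel_measurable M" for b
    by measurable
  have "(\<integral>\<^sup>+y. ennreal (norm (R *v (v y *v f y))) \<partial>M) \<le>
      (\<integral>\<^sup>+y. (\<Sum>b\<in>Basis. ennreal \<bar>(R *v (v y *v f y)) \<bullet> b\<bar>) \<partial>M)"
    by (intro nn_integral_mono) (simp add: sum_ennreal norm_le_l1 ennreal_leI)
  also have "\<dots> = (\<Sum>b\<in>Basis. \<integral>\<^sup>+y. ennreal \<bar>(R *v (v y *v f y)) \<bullet> b\<bar> \<partial>M)"
    by (intro nn_integral_sum meas)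
  also have "\<dots> \<le> (\<Sum>b\<in>(Basis :: (complex^'n) set). ?N)"
  proof (rule sum_mono)
    fix b :: "complex^'n" assume "b \<in> Basis"
    then show "(\<integral>\<^sup>+y. ennreal \<bar>(R *v (v y *v f y)) \<bullet> b\<bar> \<partial>M) \<le> ?N"
      using reduced_component_le[OF pp q assms(4-6) R, of b] by simp
  qed
  also have "\<dots> = ennreal (real DIM(complex^'n)) * ?N"
    unfolding sum_constant ennreal_of_nat_eq_real_of_nat ..
  finally show ?thesis .
qed

text \<open>For p = 1 the class bounds the integral in x for almost every fixed y, so the reducing
  property can be applied pointwise, to the vector \<open>v y *v f y\<close>, and no vector integral
  is required.\<close>

lemma reduced_integral_le_one:
  fixes u v :: "'a \<Rightarrow> complex^'n^'n" and f :: "'a \<Rightarrow> complex^'n" and R :: "complex^'n^'n"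
  assumes q: "0 < q"
    and [measurable]: "u \<in> borel_measurable M" "v \<in> borel_measurable M" "f \<in> borel_measurable M"
    and R: "\<And>e. ennreal (norm (R *v e)) \<le>
      K * epowr (\<kappa> * (\<integral>\<^sup>+x. ennreal (norm (u x *v e) powr q) \<partial>M)) (1 / q)"
    and B: "AE y in M. \<kappa> * (\<integral>\<^sup>+x. ennreal (op_norm (u x ** v y) powr q) \<partial>M) \<le> B"
  shows "(\<integral>\<^sup>+y. ennreal (norm (R *v (v y *v f y))) \<partial>M) \<le>
      K * epowr B (1 / q) * (\<integral>\<^sup>+y. ennreal (norm (f y)) \<partial>M)"
proof -
  have "(\<integral>\<^sup>+y. ennreal (norm (R *v (v y *v f y))) \<partial>M) \<le>
      (\<integral>\<^sup>+y. K * epowr B (1 / q) * ennreal (norm (f y)) \<partial>M)"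
  proof (rule nn_integral_mono_AE, use B in eventually_elim)
    fix y assume B: "\<kappa> * (\<integral>\<^sup>+x. ennreal (op_norm (u x ** v y) powr q) \<partial>M) \<le> B"
    have "(\<integral>\<^sup>+x. ennreal (norm (u x *v (v y *v f y)) powr q) \<partial>M) \<le>
        (\<integral>\<^sup>+x. ennreal (op_norm (u x ** v y) powr q) * ennreal (norm (f y) powr q) \<partial>M)"
    proof (rule nn_integral_mono)
      fix x
      have "norm (u x *v (v y *v f y)) powr q \<le> (op_norm (u x ** v y) * norm (f y)) powr q"
        using q norm_matrix_vector_le[of "u x ** v y" "f y"]
        by (intro powr_mono2) (auto simp: matrix_vector_mul_assoc)
      then show "ennreal (norm (u x *v (v y *v f y)) powr q) \<le>
          ennreal (op_norm (u x ** v y) powr q) * ennreal (norm (f y) powr q)"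
        by (simp add: powr_mult flip: ennreal_mult)
    qed
    also have "\<dots> = (\<integral>\<^sup>+x. ennreal (op_norm (u x ** v y) powr q) \<partial>M) * ennreal (norm (f y) powr q)"
      by (rule nn_integral_multc) measurable
    finally have le: "(\<integral>\<^sup>+x. ennreal (norm (u x *v (v y *v f y)) powr q) \<partial>M) \<le> \<dots>" .
    have "ennreal (norm (R *v (v y *v f y))) \<le>
       K * epowr (\<kappa> * (\<integral>\<^sup>+x. ennreal (norm (u x *v (v y *v f y)) powr q) \<partial>M)) (1 / q)" by (rule R)
    also have "\<dots> \<le> K * epowr (\<kappa> * ((\<integral>\<^sup>+x. ennreal (op_norm (u x ** v y) powr q) \<partial>M) * ennreal (norm (f y) powr q))) (1 / q)"
      using q le by (intro mult_left_mono epowr_mono) auto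
    also have "\<dots> \<le> K * epowr (B * ennreal (norm (f y) powr q)) (1 / q)"
      unfolding mult.assoc[symmetric] using q B
      by (intro mult_left_mono epowr_mono mult_right_mono) auto
    also have "\<dots> = K * epowr B (1 / q) * ennreal (norm (f y))"
      using q by (simp add: epowr_mult epowr_ennreal powr_powr mult.assoc)
    finally show "ennreal (norm (R *v (v y *v f y))) \<le> K * epowr B (1 / q) * ennreal (norm (f y))" .
  qed
  also have "\<dots> = K * epowr B (1 / q) * (\<integral>\<^sup>+y. ennreal (norm (f y)) \<partial>M)"
    by (rule nn_integral_cmult) measurable
  finally show ?thesis .
qed

section \<open>Testing the averages\<close>

text \<open>The sum is at most the number of terms times the largest one, whose power occurs on the
  right; this treats exponents below and above 1 alike.\<close>

lemma sum_powr_le: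
  fixes a :: "'i \<Rightarrow> real"
  assumes "finite I" "0 \<le> s" and a: "\<And>i. i \<in> I \<Longrightarrow> 0 \<le> a i"
  shows "(\<Sum>i\<in>I. a i) powr s \<le> real (card I) powr s * (\<Sum>i\<in>I. a i powr s)"
proof (cases "I = {}")
  case False
  define m where "m = Max (a ` I)"
  have "m \<in> a ` I" unfolding m_def using assms False by (intro Max_in) auto
  then obtain j where j: "j \<in> I" "m = a j" by blast
  have "a i \<le> m" if "i \<in> I" for i using that assms by (simp add: m_def)
  then have "(\<Sum>i\<in>I. a i) \<le> real (card I) * m" using sum_bounded_above[of I a m] by simp
  then have "(\<Sum>i\<in>I. a i) powr s \<le> (real (card I) * m) powr s"
    using assms by (intro powr_mono2 sum_nonneg) auto
  also have "\<dots> = real (card I) powr s * a j powr s" by (simp add: powr_mult j)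
  also have "\<dots> \<le> real (card I) powr s * (\<Sum>i\<in>I. a i powr s)"
    using assms j by (intro mult_left_mono member_le_sum) auto
  finally show ?thesis .
qed simp

lemma op_norm_powr_le:
  fixes A :: "complex^'n^'n"
  assumes "0 \<le> s"
  shows "op_norm A powr s \<le> real CARD('n) powr s * (\<Sum>i\<in>UNIV. norm (A *v axis i 1) powr s)"
  using powr_mono2[OF assms op_norm_nonneg op_norm_le_columns[of A]]
    sum_powr_le[OF finite[of UNIV] assms, of "\<lambda>i. norm (A *v axis i 1)"]
  by simp

lemma norm_axis_complex [simp]: "norm (axis i 1 :: complex^'n) = 1"
  by (simp add: norm_eq_sqrt_inner inner_axis_axis)

text \<open>The exponent s + 1 has two sources: s from raising a sum of n column norms to the power
  s, and 1 from adding up n integrals.\<close>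

lemma nn_integral_op_norm_le:
  fixes A :: "'a \<Rightarrow> complex^'n^'n"
  assumes [measurable]: "A \<in> borel_measurable M" and s: "0 \<le> s"
    and B: "\<And>i. (\<integral>\<^sup>+x. ennreal (norm (A x *v axis i 1) powr s) \<partial>M) \<le> B"
  shows "(\<integral>\<^sup>+x. ennreal (op_norm (A x) powr s) \<partial>M) \<le> ennreal (real CARD('n) powr (s + 1)) * B"
proof -
  have "(\<integral>\<^sup>+x. ennreal (op_norm (A x) powr s) \<partial>M) \<le>
      (\<integral>\<^sup>+x. ennreal (real CARD('n) powr s) * (\<Sum>i\<in>UNIV. ennreal (norm (A x *v axis i 1) powr s)) \<partial>M)"
    by (intro nn_integral_mono)
      (simp add: sum_ennreal sum_nonneg ennreal_leI op_norm_powr_le[OF s] flip: ennreal_mult)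
  also have "\<dots> = ennreal (real CARD('n) powr s) *
      (\<Sum>i\<in>UNIV. \<integral>\<^sup>+x. ennreal (norm (A x *v axis i 1) powr s) \<partial>M)"
    by (simp add: nn_integral_cmult nn_integral_sum del: sum_ennreal)
  also have "\<dots> \<le> ennreal (real CARD('n) powr s) * (\<Sum>i\<in>(UNIV :: 'n set). B)"
    by (intro mult_left_mono sum_mono B) simp
  also have "\<dots> = ennreal (real CARD('n) powr (s + 1)) * B"
    by (simp add: powr_add ennreal_mult ennreal_of_nat_eq_real_of_nat mult_ac)
  finally show ?thesis .
qed

text \<open>The test function \<open>min(g,k)\<^sup>p\<^sup>'\<^sup>-\<^sup>1 e\<close> is the extremal one of Hoelder's inequality,
  truncated to be in \<open>L\<^sup>p\<close>.\<close>
lemma (in finite_measure) testing_Lp: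
  fixes G :: "'a \<Rightarrow> complex^'n^'n" and e :: "complex^'n"
  assumes pp: "1 < p" "p' = p / (p - 1)" and e: "norm e = 1"
    and [measurable]: "G \<in> borel_measurable M"
    and test: "\<And>f :: 'a \<Rightarrow> complex^'n. f \<in> borel_measurable M \<Longrightarrow>
      (\<integral>\<^sup>+y. ennreal (norm (f y) powr p) \<partial>M) < top \<Longrightarrow>
      (\<integral>\<^sup>+y. ennreal (norm (G y *v f y)) \<partial>M) \<le> B * epowr (\<integral>\<^sup>+y. ennreal (norm (f y) powr p) \<partial>M) (1 / p)"
  shows "(\<integral>\<^sup>+y. ennreal (norm (G y *v e) powr p') \<partial>M) \<le> epowr B p'"
proof -
  have p': "1 < p'" "1 / p' + 1 / p = 1"
    using pp by (simp_all add: less_divide_eq diff_divide_distrib)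
  \<comment> \<open>With this identity the p-th power of the norm of the test function is the
    truncated p'-th power itself, so \<open>I k\<close> appears on both sides of the test.\<close>
  have pp': "(p' - 1) * p = p'" using pp by (simp add: field_simps)
  define g where "g y = norm (G y *v e)" for y
  have [measurable]: "g \<in> borel_measurable M" unfolding g_def by measurable
  have gpos: "0 \<le> g y" for y by (simp add: g_def)
  define m where "m k y = min (g y) (real k)" for k :: nat and y
  have [measurable]: "m k \<in> borel_measurable M" for k unfolding m_def by measurable
  have mpos: "0 \<le> m k y" for k y by (simp add: m_def gpos)
  define I where "I k = (\<integral>\<^sup>+y. ennreal (m k y powr p') \<partial>M)" for k
  have le: "I k \<le> epowr B p'" for k
  proof -
    have "I k \<le> (\<integral>\<^sup>+y. ennreal (real k powr p') \<partial>M)"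
      unfolding I_def using p' mpos by (intro nn_integral_mono ennreal_leI powr_mono2) (auto simp: m_def)
    \<comment> \<open>Finiteness, due to the truncation and the finite measure, permits cancelling
      the power 1/p of \<open>I k\<close> below.\<close>
    also have "\<dots> < top" by (simp add: emeasure_eq_measure ennreal_mult_less_top)
    finally have fin: "I k < top" .
    define f where "f y = (m k y powr (p' - 1)) *\<^sub>R e" for y
    have [measurable]: "f \<in> borel_measurable M" unfolding f_def by measurable
    have If: "(\<integral>\<^sup>+y. ennreal (norm (f y) powr p) \<partial>M) = I k"
      unfolding I_def by (intro nn_integral_cong) (simp add: f_def e powr_powr pp')
    have "I k \<le> (\<integral>\<^sup>+y. ennreal (norm (G y *v f y)) \<partial>M)"
      unfolding I_def
    proof (intro nn_integral_mono ennreal_leI)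
      fix y
      have "m k y powr p' = m k y powr (p' - 1) * m k y"
        using mpos[of k y] powr_add[of "m k y" "p' - 1" 1] by simp
      also have "\<dots> \<le> m k y powr (p' - 1) * g y"
        by (intro mult_left_mono) (auto simp: m_def)
      also have "\<dots> = norm (G y *v f y)"
        by (simp add: f_def matrix_mult_scaleR g_def)
      finally show "m k y powr p' \<le> norm (G y *v f y)" .
    qed
    also have "\<dots> \<le> B * epowr (I k) (1 / p)"
      using test[of f] fin by (simp add: If)
    finally have "I k \<le> B * epowr (I k) (1 / p)" .
    moreover have "I k = epowr (I k) (1 / p') * epowr (I k) (1 / p)"
      using epowr_add[of "I k" "1 / p'" "1 / p"] p'(2) by simp
    ultimately have *: "epowr (I k) (1 / p) * epowr (I k) (1 / p') \<le> epowr (I k) (1 / p) * B"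
      by (simp add: mult.commute)
    show ?thesis
    proof (cases "I k = 0")
      case False
      then have "epowr (I k) (1 / p') \<le> B"
        using * fin by (subst (asm) ennreal_mult_le_mult_iff) auto
      then have "epowr (epowr (I k) (1 / p')) p' \<le> epowr B p'"
        using p' by (intro epowr_mono) auto
      then show ?thesis using p' by (simp add: epowr_epowr)
    qed simp
  qed
  have "(\<integral>\<^sup>+y. ennreal (g y powr p') \<partial>M) = (\<integral>\<^sup>+y. (SUP k. ennreal (m k y powr p')) \<partial>M)"
  proof (intro nn_integral_cong antisym)
    fix y
    obtain k where "g y \<le> real k" using real_arch_simple by blast
    then show "ennreal (g y powr p') \<le> (SUP k. ennreal (m k y powr p'))"
      by (intro SUP_upper2[of k]) (auto simp: m_def)
    show "(SUP k. ennreal (m k y powr p')) \<le> ennreal (g y powr p')"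
      using p' mpos by (intro SUP_least ennreal_leI powr_mono2) (auto simp: m_def)
  qed
  also have "\<dots> = (SUP k. I k)"
    unfolding I_def
  proof (intro nn_integral_monotone_convergence_SUP)
    show "incseq (\<lambda>k y. ennreal (m k y powr p'))"
      using p' mpos by (auto simp: incseq_def le_fun_def m_def gpos intro!: ennreal_leI powr_mono2)
  qed measurable
  also have "\<dots> \<le> epowr B p'" by (intro SUP_least le)
  finally show ?thesis by (simp add: g_def)
qed

text \<open>On the set \<open>E\<close> where the bound fails, testing with its indicator gives B
  |E| plus the integrated excess on the left and B |E| on the right. Since B |E| is finite, the
  excess integrates to 0 and \<open>E\<close> is null.\<close>

lemma (in finite_measure) testing_L1:
  fixes G :: "'a \<Rightarrow> complex^'n^'n" and e :: "complex^'n"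
  assumes e: "norm e = 1" and B: "0 \<le> B"
    and [measurable]: "G \<in> borel_measurable M"
    and test: "\<And>f :: 'a \<Rightarrow> complex^'n. f \<in> borel_measurable M \<Longrightarrow>
      (\<integral>\<^sup>+y. ennreal (norm (f y)) \<partial>M) < top \<Longrightarrow>
      (\<integral>\<^sup>+y. ennreal (norm (G y *v f y)) \<partial>M) \<le> ennreal B * (\<integral>\<^sup>+y. ennreal (norm (f y)) \<partial>M)"
  shows "AE y in M. norm (G y *v e) \<le> B"
proof -
  define E where "E = {y \<in> space M. B < norm (G y *v e)}"
  have [measurable]: "E \<in> sets M" unfolding E_def by measurable
  define f where "f y = indicat_real E y *\<^sub>R e" for y
  have [measurable]: "f \<in> borel_measurable M" unfolding f_def by measurable
  have If: "(\<integral>\<^sup>+y. ennreal (norm (f y)) \<partial>M) = emeasure M E"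
  proof -
    have "(\<integral>\<^sup>+y. ennreal (norm (f y)) \<partial>M) = (\<integral>\<^sup>+y. indicator E y \<partial>M)"
      by (intro nn_integral_cong) (simp add: f_def e indicator_def)
    then show ?thesis by simp
  qed
  define X where "X = (\<integral>\<^sup>+y. ennreal (norm (G y *v e) - B) * indicator E y \<partial>M)"
  have "ennreal B * emeasure M E + X =
      (\<integral>\<^sup>+y. ennreal B * indicator E y + ennreal (norm (G y *v e) - B) * indicator E y \<partial>M)"
    unfolding X_def by (simp add: nn_integral_add nn_integral_cmult)
  also have "\<dots> = (\<integral>\<^sup>+y. ennreal (norm (G y *v f y)) \<partial>M)"
    by (intro nn_integral_cong)
      (use B in \<open>auto simp: f_def matrix_mult_scaleR E_def indicator_def simp flip: ennreal_plus\<close>)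
  also have "\<dots> \<le> ennreal B * emeasure M E"
    using test[of f] by (simp add: If emeasure_eq_measure)
  finally have "ennreal B * emeasure M E + X \<le> ennreal B * emeasure M E + 0" by simp
  then have "X = 0"
    by (subst (asm) ennreal_add_left_cancel_le) (auto simp: emeasure_eq_measure ennreal_mult_eq_top_iff)
  then have "AE y in M. ennreal (norm (G y *v e) - B) * indicator E y = 0"
    unfolding X_def by (subst (asm) nn_integral_0_iff_AE) auto
  then show ?thesis
    by (rule AE_mp, intro AE_I2) (auto simp: E_def indicator_def ennreal_eq_0_iff split: if_splits)
qed

section \<open>The two-weight inequality\<close>

text \<open>Translates between the integrals of the definitions and the restricted measure, which is
  finite and hence admits the estimates of the two preceding sections.\<close>

lemma nn_integral_cube:
  "(\<integral>\<^sup>+x\<in>cube c l. g x \<partial>lebesgue) = (\<integral>\<^sup>+x. g x \<partial>restrict_space lebesgue (cube c l))"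
  by (simp add: nn_integral_restrict_space)

lemma finite_measure_cube:
  assumes "0 < l"
  shows "finite_measure (restrict_space lebesgue (cube c l))"
proof (rule finite_measureI)
  have "emeasure (restrict_space lebesgue (cube c l)) (space (restrict_space lebesgue (cube c l))) =
      emeasure lebesgue (cube c l)"
    by (subst emeasure_restrict_space) (auto simp: space_restrict_space)
  then show "emeasure (restrict_space lebesgue (cube c l)) (space (restrict_space lebesgue (cube c l))) \<noteq> \<infinity>"
    by (simp only: emeasure_cube[OF assms]) simp
qed

lemma borel_measurable_cube:
  "f \<in> borel_measurable lebesgue \<Longrightarrow> f \<in> borel_measurable (restrict_space lebesgue (cube c l))"
  by (rule measurable_restrict_space1)

lemma psi_pos: "0 < \<rho> c \<Longrightarrow> 0 < l \<Longrightarrow> 0 < psi \<rho> \<theta> c l"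
proof -
  assume "0 < \<rho> c" "0 < l"
  then have "0 < 1 + l / \<rho> c" by (simp add: add_pos_pos)
  then show ?thesis unfolding psi_def powr_gt_zero by linarith
qed

text \<open>The base of the power is at least 1. This is how a bound for the exponent \<theta>/3
  becomes available for \<theta>.\<close>

lemma psi_mono: "0 < \<rho> c \<Longrightarrow> 0 < l \<Longrightarrow> \<theta> \<le> \<theta>' \<Longrightarrow> psi \<rho> \<theta> c l \<le> psi \<rho> \<theta>' c l"
  unfolding psi_def by (intro powr_mono) auto

lemma reducing_operators_cube:
  assumes "reducing_operators K1 K2 q U R" "0 < l"
  shows "positive_definite (R c l)"
    and "ennreal K1 * epowr (ennreal (1 / vol c l) * (\<integral>\<^sup>+x. ennreal (norm (matrix_powr (U x) (1 / q) *v e) powr q)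
          \<partial>restrict_space lebesgue (cube c l))) (1 / q) \<le> ennreal (norm (R c l *v e))"
    and "ennreal (norm (R c l *v e)) \<le> ennreal K2 * epowr (ennreal (1 / vol c l) *
          (\<integral>\<^sup>+x. ennreal (norm (matrix_powr (U x) (1 / q) *v e) powr q)
          \<partial>restrict_space lebesgue (cube c l))) (1 / q)"
  using assms unfolding reducing_operators_def nn_integral_cube Let_def by blast+

lemma Apq_const_ge:
  assumes "p \<noteq> 1" "p' = p / (p - 1)" "0 < l" and s: "s = psi \<rho> \<theta> c l * vol c l"
  shows "ennreal (1 / s) * (\<integral>\<^sup>+x. epowr (ennreal (1 / s) * (\<integral>\<^sup>+y. ennreal (op_norm
      (matrix_powr (U x) (1 / q) ** matrix_powr (V y) (- 1 / q)) powr p')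
      \<partial>restrict_space lebesgue (cube c l))) (q / p') \<partial>restrict_space lebesgue (cube c l))
    \<le> Apq_const p q \<rho> \<theta> U V"
  unfolding Apq_const_def Let_def nn_integral_cube assms(2) s if_not_P[OF assms(1)]
  using assms(3) by (intro SUP_upper2[of "(c, l)"]) auto

lemma Apq_const_one_ge:
  assumes "0 < l" and s: "s = psi \<rho> \<theta> c l * vol c l"
  shows "AE y in restrict_space lebesgue (cube c l).
    ennreal (1 / s) * (\<integral>\<^sup>+x. ennreal (op_norm
      (matrix_powr (U x) (1 / q) ** matrix_powr (V y) (- 1 / q)) powr q)
      \<partial>restrict_space lebesgue (cube c l)) \<le> Apq_const 1 q \<rho> \<theta> U V"
proof -
  have le: "esssup (restrict_space lebesgue (cube c l)) (\<lambda>y. ennreal (1 / s) * (\<integral>\<^sup>+x. ennreal (op_norm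
      (matrix_powr (U x) (1 / q) ** matrix_powr (V y) (- 1 / q)) powr q)
      \<partial>restrict_space lebesgue (cube c l))) \<le> Apq_const 1 q \<rho> \<theta> U V"
    unfolding Apq_const_def nn_integral_cube s if_P[OF refl]
    using assms(1) by (intro SUP_upper2[of "(c, l)"]) auto
  show ?thesis by (rule eventually_mono[OF esssup_AE order_trans[OF _ le]])
qed

section \<open>From the two-weight condition to the weak-type bounds\<close>

lemma exponent_identity:
  assumes "p \<noteq> 0" "p \<noteq> 1" "p' = p / (p - 1)" "1 / p - 1 / q = \<alpha> / (d::real)"
  shows "1 - \<alpha> / d = 1 / q + 1 / p'"
  using assms by (simp add: diff_divide_distrib flip: assms(4))

text \<open>The factor |Q|^(1/q) on the left absorbs the plain average in the reducing property,
  which carries no \<psi>. What remains is normalized by powers of \<psi>(Q)|Q|, as in the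
  class.\<close>

lemma cube_mean_le:
  fixes U V :: "real^'d \<Rightarrow> complex^'n^'n" and f :: "real^'d \<Rightarrow> complex^'n"
  assumes \<rho>: "\<And>x. 0 < \<rho> x" and \<theta>: "\<theta>' \<le> \<theta>" and p: "1 \<le> p" "p \<le> q"
    and \<alpha>: "1 / p - 1 / q = \<alpha> / real CARD('d)" and K2: "0 < K2"
    and U: "matrix_weight U" and V: "matrix_weight V" and R: "reducing_operators K1 K2 q U R"
    and f: "f \<in> borel_measurable lebesgue" and l: "0 < l"
  shows "cube_mean \<rho> \<theta> \<alpha> q R V c l f * ennreal (vol c l powr (1 / q)) \<le>
    ennreal (real DIM(complex^'n) * K2) * epowr (Apq_const p q \<rho> \<theta>' U V) (1 / q) *
    epowr (\<integral>\<^sup>+x\<in>cube c l. ennreal (norm (f x) powr p) \<partial>lebesgue) (1 / p)"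
proof -
  define M where "M = restrict_space lebesgue (cube c l)"
  interpret finite_measure M unfolding M_def using l by (rule finite_measure_cube)
  define u v where "u x = matrix_powr (U x) (1 / q)" and "v y = matrix_powr (V y) (- 1 / q)" for x y
  have meas [measurable]: "u \<in> borel_measurable M" "v \<in> borel_measurable M" "f \<in> borel_measurable M"
    unfolding M_def u_def v_def using U V f
    by (auto intro!: borel_measurable_cube borel_measurable_matrix_powr)
  define A where "A = epowr (Apq_const p q \<rho> \<theta>' U V) (1 / q)"
  define L where "L = epowr (\<integral>\<^sup>+x. ennreal (norm (f x) powr p) \<partial>M) (1 / p)"
  define X where "X = (\<integral>\<^sup>+y. ennreal (norm (R c l *v (v y *v f y))) \<partial>M)"
  define w s s' where "w = vol c l" and "s = psi \<rho> \<theta> c l * w" and "s' = psi \<rho> \<theta>' c l * w"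
  define N where "N = real DIM(complex^'n)"
  have N: "1 \<le> N" unfolding N_def using DIM_positive[where 'a="complex^'n"] by linarith
  have w: "0 < w" unfolding w_def using l by (rule vol_pos)
  have ss: "0 < s'" "s' \<le> s" "0 < s"
    using w psi_pos[of \<rho> c l] psi_mono[of \<rho> c l, OF \<rho> l \<theta>] \<rho> l
    by (auto simp: s_def s'_def intro!: mult_right_mono)
  have q: "0 < q" "1 \<le> q" using p by auto
  define e where "e = 1 - \<alpha> / real CARD('d)"
  have mean: "cube_mean \<rho> \<theta> \<alpha> q R V c l f = ennreal (1 / s powr e) * X"
    unfolding cube_mean_def nn_integral_cube X_def M_def s_def w_def e_def v_def ..
  note Rb = reducing_operators_cube(3)[OF R l, of c, folded M_def u_def w_def]
  have wq: "ennreal (w powr - (1 / q)) * ennreal (w powr (1 / q)) = 1"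
    using w by (simp add: powr_add[symmetric] flip: ennreal_mult)
  have "ennreal (1 / s powr e) * X * ennreal (w powr (1 / q)) \<le> ennreal (N * K2) * A * L"
  proof (cases "p = 1")
    case False
    define p' where "p' = p / (p - 1)"
    have p1: "1 < p" using p False by simp
    have p': "1 < p'" using p1 by (simp add: p'_def less_divide_eq)
    have e: "e = 1 / q + 1 / p'"
      unfolding e_def using p1 p'_def \<alpha> by (intro exponent_identity) auto
    have e0: "0 \<le> e" using e p' q by simp
    define I where "I x = (\<integral>\<^sup>+y. ennreal (op_norm (u x ** v y) powr p') \<partial>M)" for x
    have [measurable]: "I \<in> borel_measurable M"
      unfolding I_def by (intro borel_measurable_kernel meas)
    define J where "J = (\<integral>\<^sup>+x. epowr (I x) (q / p') \<partial>M)"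
    have "ennreal (1 / s') * (\<integral>\<^sup>+x. epowr (ennreal (1 / s') * I x) (q / p') \<partial>M) \<le> Apq_const p q \<rho> \<theta>' U V"
      unfolding I_def M_def u_def v_def
      by (rule Apq_const_ge) (use False p'_def l s'_def w_def in auto)
    also have "(\<integral>\<^sup>+x. epowr (ennreal (1 / s') * I x) (q / p') \<partial>M) = epowr (ennreal (1 / s')) (q / p') * J"
      unfolding epowr_mult J_def by (rule nn_integral_cmult) measurable
    finally have "epowr (ennreal (1 / s') * (epowr (ennreal (1 / s')) (q / p') * J)) (1 / q) \<le> A"
      unfolding A_def using q by (intro epowr_mono) auto
    \<comment> \<open>The factor 1/s' leaves the outer average with exponent 1/q and the inner one
      with exponent 1/p', altogether with exponent \<open>e\<close>.\<close>
    also have "epowr (ennreal (1 / s') * (epowr (ennreal (1 / s')) (q / p') * J)) (1 / q) =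
        ennreal (1 / s' powr e) * epowr J (1 / q)"
    proof -
      have "epowr (ennreal (1 / s') * (epowr (ennreal (1 / s')) (q / p') * J)) (1 / q) =
          epowr (ennreal (1 / s')) (1 / q) * epowr (ennreal (1 / s')) (1 / p') * epowr J (1 / q)"
        using q by (simp only: epowr_mult epowr_epowr mult.assoc) simp
      also have "epowr (ennreal (1 / s')) (1 / q) * epowr (ennreal (1 / s')) (1 / p') = epowr (ennreal (1 / s')) e"
        unfolding e epowr_add ..
      also have "\<dots> = ennreal (1 / s' powr e)" using ss by (simp add: epowr_ennreal powr_divide)
      finally show ?thesis .
    qed
    finally have JA: "ennreal (1 / s' powr e) * epowr J (1 / q) \<le> A" .
    have "X \<le> ennreal N * (ennreal K2 * epowr (ennreal (1 / w) * J) (1 / q) * L)"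
      unfolding X_def N_def J_def I_def L_def
      by (rule reduced_integral_le[OF p1 p'_def q(1) meas Rb])
    also have "epowr (ennreal (1 / w) * J) (1 / q) = ennreal (w powr - (1 / q)) * epowr J (1 / q)"
      using w by (simp add: epowr_mult epowr_ennreal powr_divide powr_minus_divide)
    finally have "ennreal (1 / s powr e) * X * ennreal (w powr (1 / q)) \<le> ennreal (1 / s powr e) *
        (ennreal N * (ennreal K2 * (ennreal (w powr - (1 / q)) * epowr J (1 / q)) * L)) * ennreal (w powr (1 / q))"
      by (intro mult_right_mono mult_left_mono) auto
    also have "\<dots> = (ennreal N * ennreal K2) * (ennreal (1 / s powr e) * epowr J (1 / q)) * L *
        (ennreal (w powr - (1 / q)) * ennreal (w powr (1 / q)))"
      by (simp only: mult_ac)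
    also have "\<dots> = ennreal (N * K2) * (ennreal (1 / s powr e) * epowr J (1 / q)) * L"
      using N K2 by (simp add: wq ennreal_mult)
    \<comment> \<open>Here \<theta> gives way to \<theta>': since \<open>s' \<le> s\<close> and
      \<open>e \<ge> 0\<close>, the normalization with the smaller exponent is the larger
      factor.\<close>
    also have "\<dots> \<le> ennreal (N * K2) * (ennreal (1 / s' powr e) * epowr J (1 / q)) * L"
      using ss e0 by (intro mult_right_mono mult_left_mono ennreal_leI divide_left_mono powr_mono2) auto
    also have "\<dots> \<le> ennreal (N * K2) * A * L"
      by (intro mult_right_mono mult_left_mono JA) auto
    finally show ?thesis .
  next
    case True
    have e: "e = 1 / q" using \<alpha> True by (simp add: e_def)
    define \<psi>' where "\<psi>' = psi \<rho> \<theta>' c l"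
    have psi': "0 < \<psi>'" "s' = \<psi>' * w" using \<rho> l by (auto simp: \<psi>'_def psi_pos s'_def)
    have "AE y in M. ennreal (1 / s') * (\<integral>\<^sup>+x. ennreal (op_norm (u x ** v y) powr q) \<partial>M) \<le>
        Apq_const p q \<rho> \<theta>' U V"
      unfolding True M_def u_def v_def by (rule Apq_const_one_ge) (use l s'_def w_def in auto)
    \<comment> \<open>The class divides by \<psi>(Q)|Q|, the reducing property by |Q| alone; the
      difference is the factor \<open>\<psi>'\<close>, which the normalization of the mean later
      outweighs.\<close>
    then have "AE y in M. ennreal (1 / w) * (\<integral>\<^sup>+x. ennreal (op_norm (u x ** v y) powr q) \<partial>M) \<le>
        ennreal \<psi>' * Apq_const p q \<rho> \<theta>' U V"
    proof eventually_elim
      case (elim y)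
      have "ennreal (1 / w) = ennreal \<psi>' * ennreal (1 / s')"
        using psi' w by (simp flip: ennreal_mult)
      with elim show ?case by (simp add: mult.assoc mult_left_mono)
    qed
    from reduced_integral_le_one[OF q(1) meas Rb this]
    have "X \<le> ennreal K2 * epowr (ennreal \<psi>' * Apq_const p q \<rho> \<theta>' U V) (1 / q) * L"
      by (simp add: X_def L_def True)
    also have "epowr (ennreal \<psi>' * Apq_const p q \<rho> \<theta>' U V) (1 / q) = ennreal (\<psi>' powr (1 / q)) * A"
      using psi' by (simp add: A_def epowr_mult epowr_ennreal)
    finally have "ennreal (1 / s powr e) * X * ennreal (w powr (1 / q)) \<le>
        ennreal (1 / s powr e) * (ennreal K2 * (ennreal (\<psi>' powr (1 / q)) * A) * L) * ennreal (w powr (1 / q))"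
      by (intro mult_right_mono mult_left_mono) auto
    also have "\<dots> = (ennreal (1 / s powr e) * ennreal (\<psi>' powr (1 / q)) * ennreal (w powr (1 / q))) * (ennreal K2 * A * L)"
      by (simp only: mult_ac)
    also have "ennreal (1 / s powr e) * ennreal (\<psi>' powr (1 / q)) * ennreal (w powr (1 / q)) =
        ennreal (s' powr (1 / q) / s powr (1 / q))"
      by (simp add: e psi' powr_mult flip: ennreal_mult)
    also have "\<dots> * (ennreal K2 * A * L) \<le> 1 * (ennreal (N * K2) * A * L)"
    proof (rule mult_mono)
      have "s' powr (1 / q) \<le> s powr (1 / q)" using ss q by (intro powr_mono2) auto
      then show "ennreal (s' powr (1 / q) / s powr (1 / q)) \<le> 1" using ss by simp
      show "ennreal K2 * A * L \<le> ennreal (N * K2) * A * L"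
        using N K2 by (intro mult_right_mono ennreal_leI) auto
    qed auto
    finally show ?thesis by simp
  qed
  then show ?thesis
    unfolding mean w_def N_def A_def L_def M_def nn_integral_cube .
qed

text \<open>The single-cube bound raised to the power q is the hypothesis of the covering estimate,
  with density |f|^p, exponent q/p and constant t^(-q) H^q. Taking the q-th root of its conclusion
  gives 1/t, which the factor t of the weak norm cancels.\<close>

lemma weak_maximal_le:
  fixes U V :: "real^'d \<Rightarrow> complex^'n^'n" and f :: "real^'d \<Rightarrow> complex^'n"
  assumes \<rho>: "\<And>x. 0 < \<rho> x" and \<theta>: "\<theta>' \<le> \<theta>" and p: "1 \<le> p" "p \<le> q"
    and \<alpha>: "1 / p - 1 / q = \<alpha> / real CARD('d)" and K2: "0 < K2"
    and U: "matrix_weight U" and V: "matrix_weight V" and R: "reducing_operators K1 K2 q U R"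
    and f: "f \<in> Lp_space p" and A: "Apq_const p q \<rho> \<theta>' U V < top"
  shows "weak_Lp_norm q (maximal_op \<rho> \<theta> \<alpha> q R V f) \<le>
    ennreal (((10 * real CARD('d)) ^ CARD('d)) powr (1 / q) * (real DIM(complex^'n) * K2)) *
    epowr (Apq_const p q \<rho> \<theta>' U V) (1 / q) * Lp_norm p f"
  unfolding weak_Lp_norm_def
proof (rule SUP_least)
  fix t :: real assume "t \<in> {0<..}"
  then have t: "0 < t" by simp
  have q: "0 < q" using p by simp
  have fm [measurable]: "f \<in> borel_measurable lebesgue" and fin: "Lp_norm p f < top"
    using f by (auto simp: Lp_space_def)
  define H where "H = ennreal (real DIM(complex^'n) * K2) * epowr (Apq_const p q \<rho> \<theta>' U V) (1 / q)"
  define \<mu> where "\<mu> c l = (\<integral>\<^sup>+x\<in>cube c l. ennreal (norm (f x) powr p) \<partial>lebesgue)" for c l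
  define S where "S = {(c, l). 0 < l \<and> ennreal t < cube_mean \<rho> \<theta> \<alpha> q R V c l f}"
  define D where "D = (10 * real CARD('d)) ^ CARD('d)"
  define tot where "tot = (\<integral>\<^sup>+x. ennreal (norm (f x) powr p) \<partial>lebesgue)"
  \<comment> \<open>The mean depends on the cube only, so a cube whose mean exceeds t lies in the
    level set with all its points.\<close>
  have set_eq: "{x. maximal_op \<rho> \<theta> \<alpha> q R V f x > ennreal t} = (\<Union>(c, l)\<in>S. cube c l)"
    by (auto simp: maximal_op_def less_SUP_iff S_def)
  have "emeasure lebesgue (\<Union>(c, l)\<in>S. cube c l) \<le>
      ennreal ((10 * real CARD('d)) ^ CARD('d)) * (ennreal (t powr - q) * epowr H q * epowr tot (q / p))"
    unfolding tot_def
  proof (rule emeasure_UN_cubes_le)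
    show "(\<integral>\<^sup>+x. ennreal (norm (f x) powr p) \<partial>lebesgue) < top"
      using fin by (simp add: Lp_norm_def)
    show "ennreal (t powr - q) * epowr H q < top"
      using A by (simp add: H_def ennreal_mult_less_top)
    show "1 \<le> q / p" using p by simp
    fix c l assume "(c, l) \<in> S"
    then have l: "0 < l" and tm: "ennreal t \<le> cube_mean \<rho> \<theta> \<alpha> q R V c l f" by (auto simp: S_def)
    have v: "0 < vol c l" using l by (rule vol_pos)
    have "ennreal t * ennreal (vol c l powr (1 / q)) \<le> cube_mean \<rho> \<theta> \<alpha> q R V c l f * ennreal (vol c l powr (1 / q))"
      by (intro mult_right_mono tm) simp
    also have "\<dots> \<le> H * epowr (\<mu> c l) (1 / p)"
      unfolding H_def \<mu>_def by (rule cube_mean_le[OF \<rho> \<theta> p \<alpha> K2 U V R fm l])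
    finally have "epowr (ennreal t * ennreal (vol c l powr (1 / q))) q \<le> epowr (H * epowr (\<mu> c l) (1 / p)) q"
      using q by (intro epowr_mono) auto
    then have le: "ennreal (t powr q) * ennreal (vol c l) \<le> epowr H q * epowr (\<mu> c l) (q / p)"
      using t v q by (simp add: epowr_mult epowr_epowr epowr_ennreal powr_powr)
    have "ennreal (vol c l) = ennreal (t powr - q) * (ennreal (t powr q) * ennreal (vol c l))"
      using t v by (simp add: powr_minus flip: ennreal_mult)
    also have "\<dots> \<le> ennreal (t powr - q) * (epowr H q * epowr (\<mu> c l) (q / p))"
      by (intro mult_left_mono le) simp
    finally show "0 < l \<and> ennreal (vol c l) \<le> ennreal (t powr - q) * epowr H q *
        epowr (\<integral>\<^sup>+x\<in>cube c l. ennreal (norm (f x) powr p) \<partial>lebesgue) (q / p)"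
      using l by (simp add: \<mu>_def mult.assoc)
  qed measurable
  then have "ennreal t * epowr (emeasure lebesgue (\<Union>(c, l)\<in>S. cube c l)) (1 / q) \<le>
      ennreal t * epowr (ennreal D * (ennreal (t powr - q) * epowr H q * epowr tot (q / p))) (1 / q)"
    unfolding D_def using q by (intro mult_left_mono epowr_mono) auto
  also have "\<dots> = ennreal t * (ennreal (D powr (1 / q)) * (ennreal (1 / t) * H * epowr tot (1 / p)))"
  proof -
    have "(t powr - q) powr (1 / q) = 1 / t"
      using t q by (simp add: powr_minus_divide powr_divide powr_powr)
    then show ?thesis using q by (simp add: epowr_mult epowr_epowr epowr_ennreal D_def)
  qed
  also have "\<dots> = ennreal (D powr (1 / q)) * H * epowr tot (1 / p) * (ennreal t * ennreal (1 / t))"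
    by (simp only: mult_ac)
  also have "ennreal t * ennreal (1 / t) = 1" using t by (simp flip: ennreal_mult)
  also have "ennreal (D powr (1 / q)) * H * epowr tot (1 / p) * 1 =
      ennreal (D powr (1 / q) * (real DIM(complex^'n) * K2)) * epowr (Apq_const p q \<rho> \<theta>' U V) (1 / q) * Lp_norm p f"
    using K2 by (simp add: H_def tot_def Lp_norm_def ennreal_mult mult.assoc)
  finally show "ennreal t * epowr (emeasure lebesgue {x. maximal_op \<rho> \<theta> \<alpha> q R V f x > ennreal t}) (1 / q) \<le>
    ennreal (((10 * real CARD('d)) ^ CARD('d)) powr (1 / q) * (real DIM(complex^'n) * K2)) *
    epowr (Apq_const p q \<rho> \<theta>' U V) (1 / q) * Lp_norm p f"
    unfolding set_eq D_def .
qed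

section \<open>Averaging operators against the maximal operator and the weak norm\<close>

lemma averaging_le_maximal:
  assumes "0 < l"
  shows "averaging_op \<rho> \<theta> \<alpha> q R V c l f x \<le> maximal_op \<rho> \<theta> \<alpha> q R V f x"
proof (cases "x \<in> cube c l")
  case True
  then show ?thesis unfolding maximal_op_def averaging_op_def
    using assms by (intro SUP_upper2[of "(c, l)"]) auto
qed (simp add: averaging_op_def)

text \<open>The level sets are unions of open cubes, possibly uncountable ones, hence open. Their
  measurability is what monotonicity of the measure demands of the larger set.\<close>

lemma sets_maximal_op: "{x. maximal_op \<rho> \<theta> \<alpha> q R V f x > t} \<in> sets lebesgue"
proof -
  have "{x. maximal_op \<rho> \<theta> \<alpha> q R V f x > t} =
      (\<Union>(c, l)\<in>{(c, l). 0 < l \<and> t < cube_mean \<rho> \<theta> \<alpha> q R V c l f}. cube c l)"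
    by (auto simp: maximal_op_def less_SUP_iff)
  moreover have "open \<dots>" by (intro open_UN) (auto simp: open_cube)
  ultimately show ?thesis by simp
qed

lemma weak_averaging_le_maximal:
  assumes "0 < l" "0 < q"
  shows "weak_Lp_norm q (averaging_op \<rho> \<theta> \<alpha> q R V c l f) \<le> weak_Lp_norm q (maximal_op \<rho> \<theta> \<alpha> q R V f)"
  unfolding weak_Lp_norm_def
  using assms averaging_le_maximal[OF assms(1), of \<rho> \<theta> \<alpha> q R V c f]
  by (intro SUP_mono' mult_left_mono epowr_mono emeasure_mono sets_maximal_op)
    (auto intro: less_le_trans)

text \<open>Every positive level strictly below the mean has the whole cube as its level set. The
  level sets are strict, so the mean is approached from below, which covers an infinite mean as
  well.\<close>

lemma cube_mean_le_weak_norm: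
  assumes l: "0 < l"
  shows "cube_mean \<rho> \<theta> \<alpha> q R V c l f * ennreal (vol c l powr (1 / q)) \<le>
    weak_Lp_norm q (averaging_op \<rho> \<theta> \<alpha> q R V c l f)"
proof -
  define N where "N = weak_Lp_norm q (averaging_op \<rho> \<theta> \<alpha> q R V c l f)"
  define a where "a = vol c l powr (1 / q)"
  have a: "0 < a" using vol_pos[OF l, of c] by (simp add: a_def)
  have "cube_mean \<rho> \<theta> \<alpha> q R V c l f \<le> N * ennreal (1 / a)"
  proof (rule dense_le)
    fix y assume y: "y < cube_mean \<rho> \<theta> \<alpha> q R V c l f"
    then obtain t where t: "0 \<le> t" "y = ennreal t" by (cases y) auto
    show "y \<le> N * ennreal (1 / a)"
    proof (cases "t = 0")
      case False
      have "{x. averaging_op \<rho> \<theta> \<alpha> q R V c l f x > ennreal t} = cube c l"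
        using y t by (auto simp: averaging_op_def indicator_def)
      then have "epowr (emeasure lebesgue {x. averaging_op \<rho> \<theta> \<alpha> q R V c l f x > ennreal t}) (1 / q) = ennreal a"
        using l vol_pos[OF l, of c] by (simp only: emeasure_cube_vol a_def) (simp add: epowr_ennreal)
      then have "ennreal t * ennreal a \<le> N"
        unfolding N_def weak_Lp_norm_def using False t by (intro SUP_upper2[of t]) auto
      then have "ennreal t * ennreal a * ennreal (1 / a) \<le> N * ennreal (1 / a)"
        by (intro mult_right_mono) auto
      then show ?thesis using t a by (simp flip: ennreal_mult)
    qed (simp add: t)
  qed
  then have "cube_mean \<rho> \<theta> \<alpha> q R V c l f * ennreal a \<le> N * ennreal (1 / a) * ennreal a"
    by (intro mult_right_mono) auto
  also have "\<dots> = N" using a by (simp add: mult.assoc flip: ennreal_mult)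
  finally show ?thesis by (simp add: N_def a_def)
qed

section \<open>Necessity of the two-weight condition\<close>

lemma positive_definite_inverse:
  assumes "positive_definite A"
  obtains S where "A ** S = mat 1"
proof -
  have "x = 0" if "A *v x = 0" for x
    using assms that by (force simp: positive_definite_def)
  then obtain S where "S ** A = mat 1" using matrix_left_invertible_ker[of A] by blast
  then have "A ** S = mat 1" by (simp add: matrix_left_right_inverse)
  with that show ?thesis by blast
qed

text \<open>Extension by zero makes a function on the cube admissible for the operator on the whole
  space. The constant undoes the normalization of the mean and divides by the |Q|^(1/q) coming from
  the weak norm.\<close>

lemma averaging_test_bound:
  fixes V :: "real^'d \<Rightarrow> complex^'n^'n" and f :: "real^'d \<Rightarrow> complex^'n"
  assumes \<rho>: "\<And>x. 0 < \<rho> x" and p: "1 \<le> p" and l: "0 < l" and C: "0 \<le> C"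
    and bnd: "bounded_Lp_weak_Lq p q (averaging_op \<rho> \<theta> \<alpha> q R V c l) C"
    and f: "f \<in> borel_measurable (restrict_space lebesgue (cube c l))"
    and fin: "(\<integral>\<^sup>+y. ennreal (norm (f y) powr p) \<partial>restrict_space lebesgue (cube c l)) < top"
    and s: "s = psi \<rho> \<theta> c l * vol c l" and e: "e = 1 - \<alpha> / real CARD('d)"
  shows "(\<integral>\<^sup>+y. ennreal (norm ((R c l ** matrix_powr (V y) (- 1 / q)) *v f y)) \<partial>restrict_space lebesgue (cube c l)) \<le>
    ennreal (C * s powr e / vol c l powr (1 / q)) *
    epowr (\<integral>\<^sup>+y. ennreal (norm (f y) powr p) \<partial>restrict_space lebesgue (cube c l)) (1 / p)"
proof -
  define g where "g y = indicator (cube c l) y *\<^sub>R f y" for y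
  have g: "g \<in> borel_measurable lebesgue"
    using f borel_measurable_restrict_space_iff[of "cube c l" lebesgue f] by (simp add: g_def[abs_def])
  define X where "X = (\<integral>\<^sup>+y. ennreal (norm ((R c l ** matrix_powr (V y) (- 1 / q)) *v f y)) \<partial>restrict_space lebesgue (cube c l))"
  define L where "L = (\<integral>\<^sup>+y. ennreal (norm (f y) powr p) \<partial>restrict_space lebesgue (cube c l))"
  have "(\<integral>\<^sup>+y. ennreal (norm (g y) powr p) \<partial>lebesgue) = L"
    unfolding L_def nn_integral_cube[symmetric] using p
    by (intro nn_integral_cong) (auto simp: g_def indicator_def)
  then have Lg: "Lp_norm p g = epowr L (1 / p)" by (simp add: Lp_norm_def)
  then have "g \<in> Lp_space p" using g fin by (simp add: Lp_space_def L_def)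
  then have "weak_Lp_norm q (averaging_op \<rho> \<theta> \<alpha> q R V c l g) \<le> ennreal C * epowr L (1 / p)"
    using bnd unfolding bounded_Lp_weak_Lq_def Lg[symmetric] by blast
  with cube_mean_le_weak_norm[OF l, of \<rho> \<theta> \<alpha> q R V c g]
  have "cube_mean \<rho> \<theta> \<alpha> q R V c l g * ennreal (vol c l powr (1 / q)) \<le> ennreal C * epowr L (1 / p)"
    by (rule order_trans)
  also have "cube_mean \<rho> \<theta> \<alpha> q R V c l g = ennreal (1 / s powr e) * X"
  proof -
    have "(\<integral>\<^sup>+y\<in>cube c l. ennreal (norm (R c l *v (matrix_powr (V y) (- 1 / q) *v g y))) \<partial>lebesgue) = X"
      unfolding X_def nn_integral_cube[symmetric]
      by (intro nn_integral_cong) (auto simp: g_def indicator_def matrix_vector_mul_assoc)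
    then show ?thesis by (simp add: cube_mean_def s e)
  qed
  finally have le: "ennreal (1 / s powr e) * X * ennreal (vol c l powr (1 / q)) \<le> ennreal C * epowr L (1 / p)" .
  have pos: "0 < s" "0 < vol c l" using \<rho> l by (auto simp: s psi_pos vol_pos)
  have "X = ennreal (s powr e / vol c l powr (1 / q)) * (ennreal (1 / s powr e) * X * ennreal (vol c l powr (1 / q)))"
  proof -
    have "ennreal (s powr e / vol c l powr (1 / q)) * (ennreal (1 / s powr e) * X * ennreal (vol c l powr (1 / q))) =
       (ennreal (s powr e / vol c l powr (1 / q)) * ennreal (1 / s powr e) * ennreal (vol c l powr (1 / q))) * X"
      by (simp only: mult_ac)
    also have "ennreal (s powr e / vol c l powr (1 / q)) * ennreal (1 / s powr e) * ennreal (vol c l powr (1 / q)) = 1"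
      using pos by (simp flip: ennreal_mult)
    finally show ?thesis by simp
  qed
  also have "\<dots> \<le> ennreal (s powr e / vol c l powr (1 / q)) * (ennreal C * epowr L (1 / p))"
    by (intro mult_left_mono le) simp
  also have "\<dots> = ennreal (s powr e / vol c l powr (1 / q) * C) * epowr L (1 / p)"
    using C by (simp only: ennreal_mult'' mult.assoc)
  also have "s powr e / vol c l powr (1 / q) * C = C * s powr e / vol c l powr (1 / q)"
    by simp
  finally show ?thesis by (simp add: X_def L_def)
qed

text \<open>Since \<open>S\<close> inverts the reducing operator, each column of \<open>S\<close> is
  mapped by that operator to a unit vector. The lower reducing bound at this column limits the
  average of its q-th powers by K1^(-q).\<close>

lemma nn_integral_normalized_weight_le:
  fixes U :: "real^'d \<Rightarrow> complex^'n^'n"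
  assumes q: "0 < q" and K1: "0 < K1" and U: "matrix_weight U"
    and R: "reducing_operators K1 K2 q U R" and l: "0 < l" and S: "R c l ** S = mat 1"
  shows "(\<integral>\<^sup>+x. ennreal (op_norm (matrix_powr (U x) (1 / q) ** S) powr q) \<partial>restrict_space lebesgue (cube c l)) \<le>
    ennreal (real CARD('n) powr (q + 1) * (vol c l * (1 / K1) powr q))"
proof -
  define M where "M = restrict_space lebesgue (cube c l)"
  have [measurable]: "(\<lambda>x. matrix_powr (U x) (1 / q)) \<in> borel_measurable M"
    unfolding M_def by (intro borel_measurable_cube borel_measurable_matrix_powr U)
  have v: "0 < vol c l" using l by (rule vol_pos)
  have "(\<integral>\<^sup>+x. ennreal (norm ((matrix_powr (U x) (1 / q) ** S) *v axis i 1) powr q) \<partial>M) \<le>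
      ennreal (vol c l * (1 / K1) powr q)" for i
  proof -
    define Y where "Y = (\<integral>\<^sup>+x. ennreal (norm (matrix_powr (U x) (1 / q) *v (S *v axis i 1)) powr q) \<partial>M)"
    have "ennreal K1 * epowr (ennreal (1 / vol c l) * Y) (1 / q) \<le> ennreal (norm (R c l *v (S *v axis i 1)))"
      unfolding Y_def M_def by (rule reducing_operators_cube(2)[OF R l])
    also have "\<dots> = 1" by (simp add: matrix_vector_mul_assoc S)
    finally have "ennreal (1 / K1) * (ennreal K1 * epowr (ennreal (1 / vol c l) * Y) (1 / q)) \<le> ennreal (1 / K1) * 1"
      by (rule mult_left_mono) simp
    then have "epowr (ennreal (1 / vol c l) * Y) (1 / q) \<le> ennreal (1 / K1)"
      using K1 by (simp add: mult.assoc[symmetric] flip: ennreal_mult)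
    then have "epowr (epowr (ennreal (1 / vol c l) * Y) (1 / q)) q \<le> epowr (ennreal (1 / K1)) q"
      using q by (intro epowr_mono) auto
    then have "ennreal (1 / vol c l) * Y \<le> ennreal ((1 / K1) powr q)"
      using q K1 by (simp add: epowr_epowr epowr_ennreal)
    then have "ennreal (vol c l) * (ennreal (1 / vol c l) * Y) \<le> ennreal (vol c l) * ennreal ((1 / K1) powr q)"
      by (rule mult_left_mono) simp
    then have "Y \<le> ennreal (vol c l * (1 / K1) powr q)"
      using v by (simp add: mult.assoc[symmetric] ennreal_mult) (simp flip: ennreal_mult)
    then show ?thesis by (simp add: Y_def matrix_vector_mul_assoc)
  qed
  then have "(\<integral>\<^sup>+x. ennreal (op_norm (matrix_powr (U x) (1 / q) ** S) powr q) \<partial>M) \<le>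
      ennreal (real CARD('n) powr (q + 1)) * ennreal (vol c l * (1 / K1) powr q)"
    using q by (intro nn_integral_op_norm_le) auto
  then show ?thesis unfolding M_def using v by (simp add: ennreal_mult)
qed

text \<open>With A depending on x and B on y, inserting the identity \<open>S ** R\<close> separates
  the variables, so the two integrals of the class can be estimated independently.\<close>

lemma op_norm_factor:
  fixes A B R S :: "complex^'n^'n"
  assumes "R ** S = mat 1" "0 \<le> r"
  shows "op_norm (A ** B) powr r \<le> op_norm (A ** S) powr r * op_norm (R ** B) powr r"
proof -
  have "S ** R = mat 1" using assms by (simp add: matrix_left_right_inverse)
  then have "A ** B = (A ** S) ** (R ** B)" by (metis matrix_mul_assoc matrix_mul_lid)
  then have "op_norm (A ** B) \<le> op_norm (A ** S) * op_norm (R ** B)"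
    by (simp only: op_norm_mult_le)
  then show ?thesis
    using assms(2) by (simp add: op_norm_nonneg powr_mono2 flip: powr_mult)
qed

text \<open>After separation the inner average is a constant times the p'-th power of
  \<open>op_norm (u x ** S)\<close>; its power q/p' is the q-th power, which the normalized weight
  bound integrates. The bound must not depend on the cube, so all powers of \<open>s\<close> and |Q|
  have to cancel.\<close>

lemma Apq_average_le:
  fixes U V :: "real^'d \<Rightarrow> complex^'n^'n"
  assumes \<rho>: "\<And>x. 0 < \<rho> x" and p: "1 < p" "p \<le> q" and p': "p' = p / (p - 1)"
    and \<alpha>: "1 / p - 1 / q = \<alpha> / real CARD('d)" and K1: "0 < K1" and C: "0 \<le> C"
    and U: "matrix_weight U" and V: "matrix_weight V" and R: "reducing_operators K1 K2 q U R"
    and l: "0 < l" and bnd: "bounded_Lp_weak_Lq p q (averaging_op \<rho> \<theta> \<alpha> q R V c l) C"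
    and s: "s = psi \<rho> \<theta> c l * vol c l"
  shows "ennreal (1 / s) * (\<integral>\<^sup>+x. epowr (ennreal (1 / s) * (\<integral>\<^sup>+y. ennreal (op_norm
      (matrix_powr (U x) (1 / q) ** matrix_powr (V y) (- 1 / q)) powr p')
      \<partial>restrict_space lebesgue (cube c l))) (q / p') \<partial>restrict_space lebesgue (cube c l))
    \<le> ennreal (real CARD('n) powr ((p' + 1) * (q / p')) * C powr q * real CARD('n) powr (q + 1) * (1 / K1) powr q)"
proof -
  define M where "M = restrict_space lebesgue (cube c l)"
  interpret finite_measure M unfolding M_def using l by (rule finite_measure_cube)
  define u v where "u x = matrix_powr (U x) (1 / q)" and "v y = matrix_powr (V y) (- 1 / q)" for x y
  have [measurable]: "u \<in> borel_measurable M" "v \<in> borel_measurable M"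
    unfolding M_def u_def v_def using U V
    by (auto intro!: borel_measurable_cube borel_measurable_matrix_powr)
  have q: "0 < q" and p1: "1 < p'" using p p' by (auto simp: less_divide_eq)
  define n where "n = real CARD('n)"
  define w where "w = vol c l"
  have pos: "0 < s" "0 < w" using \<rho> l by (auto simp: s w_def psi_pos vol_pos)
  define e where "e = 1 - \<alpha> / real CARD('d)"
  have e: "e = 1 / q + 1 / p'"
    unfolding e_def using p p' \<alpha> by (intro exponent_identity) auto
  define B where "B = C * s powr e / w powr (1 / q)"
  have B: "0 \<le> B" using C by (simp add: B_def)
  obtain S where S: "R c l ** S = mat 1"
    using positive_definite_inverse reducing_operators_cube(1)[OF R l] by metis
  have "(\<integral>\<^sup>+y. ennreal (norm ((R c l ** v y) *v axis i 1) powr p') \<partial>M) \<le> epowr (ennreal B) p'" for i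
  proof (rule testing_Lp[OF p(1) p'])
    fix f :: "real^'d \<Rightarrow> complex^'n"
    assume "f \<in> borel_measurable M" "(\<integral>\<^sup>+y. ennreal (norm (f y) powr p) \<partial>M) < top"
    then show "(\<integral>\<^sup>+y. ennreal (norm ((R c l ** v y) *v f y)) \<partial>M) \<le>
        ennreal B * epowr (\<integral>\<^sup>+y. ennreal (norm (f y) powr p) \<partial>M) (1 / p)"
      unfolding B_def w_def M_def v_def using p
      by (intro averaging_test_bound[OF \<rho> _ l C bnd]) (auto simp: s e_def)
  qed auto
  then have "(\<integral>\<^sup>+y. ennreal (op_norm (R c l ** v y) powr p') \<partial>M) \<le> ennreal (n powr (p' + 1)) * epowr (ennreal B) p'"
    unfolding n_def using p1 by (intro nn_integral_op_norm_le) auto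
  also have "\<dots> = ennreal (n powr (p' + 1) * B powr p')"
    using B by (simp add: epowr_ennreal ennreal_mult)
  finally have RV: "(\<integral>\<^sup>+y. ennreal (op_norm (R c l ** v y) powr p') \<partial>M) \<le> \<dots>" .
  define G where "G = n powr (p' + 1) * B powr p'"
  have inner: "epowr (ennreal (1 / s) * (\<integral>\<^sup>+y. ennreal (op_norm (u x ** v y) powr p') \<partial>M)) (q / p') \<le>
      ennreal ((G / s) powr (q / p')) * ennreal (op_norm (u x ** S) powr q)" for x
  proof -
    have "(\<integral>\<^sup>+y. ennreal (op_norm (u x ** v y) powr p') \<partial>M) \<le>
        (\<integral>\<^sup>+y. ennreal (op_norm (u x ** S) powr p') * ennreal (op_norm (R c l ** v y) powr p') \<partial>M)"
      using p1 by (intro nn_integral_mono) (simp add: ennreal_leI op_norm_factor[OF S] flip: ennreal_mult)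
    also have "\<dots> = ennreal (op_norm (u x ** S) powr p') * (\<integral>\<^sup>+y. ennreal (op_norm (R c l ** v y) powr p') \<partial>M)"
      by (rule nn_integral_cmult) measurable
    also have "\<dots> \<le> ennreal (op_norm (u x ** S) powr p') * ennreal G"
      unfolding G_def by (intro mult_left_mono RV) simp
    finally have "ennreal (1 / s) * (\<integral>\<^sup>+y. ennreal (op_norm (u x ** v y) powr p') \<partial>M) \<le>
        ennreal (1 / s) * (ennreal (op_norm (u x ** S) powr p') * ennreal G)"
      by (rule mult_left_mono) simp
    also have "\<dots> = ennreal (G / s * op_norm (u x ** S) powr p')"
      using pos by (simp add: G_def mult_ac flip: ennreal_mult)
    finally have "epowr (ennreal (1 / s) * (\<integral>\<^sup>+y. ennreal (op_norm (u x ** v y) powr p') \<partial>M)) (q / p') \<le>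
        epowr (ennreal (G / s * op_norm (u x ** S) powr p')) (q / p')"
      using p1 q by (intro epowr_mono) auto
    also have "\<dots> = ennreal ((G / s) powr (q / p')) * ennreal (op_norm (u x ** S) powr q)"
    proof -
      have "0 \<le> G / s * op_norm (u x ** S) powr p'" using pos by (simp add: G_def)
      moreover have "(G / s * op_norm (u x ** S) powr p') powr (q / p') =
          (G / s) powr (q / p') * op_norm (u x ** S) powr q"
        using p1 by (simp only: powr_mult powr_powr) simp
      ultimately show ?thesis by (simp only: epowr_ennreal) (simp add: ennreal_mult)
    qed
    finally show ?thesis .
  qed
  have "(\<integral>\<^sup>+x. epowr (ennreal (1 / s) * (\<integral>\<^sup>+y. ennreal (op_norm (u x ** v y) powr p') \<partial>M)) (q / p') \<partial>M) \<le>
      (\<integral>\<^sup>+x. ennreal ((G / s) powr (q / p')) * ennreal (op_norm (u x ** S) powr q) \<partial>M)"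
    by (intro nn_integral_mono inner)
  also have "\<dots> = ennreal ((G / s) powr (q / p')) * (\<integral>\<^sup>+x. ennreal (op_norm (u x ** S) powr q) \<partial>M)"
    by (rule nn_integral_cmult) measurable
  also have "\<dots> \<le> ennreal ((G / s) powr (q / p')) * ennreal (n powr (q + 1) * (w * (1 / K1) powr q))"
    unfolding M_def u_def n_def w_def
    by (intro mult_left_mono nn_integral_normalized_weight_le[OF q K1 U R l S]) simp
  finally have "ennreal (1 / s) * (\<integral>\<^sup>+x. epowr (ennreal (1 / s) * (\<integral>\<^sup>+y. ennreal (op_norm (u x ** v y) powr p') \<partial>M)) (q / p') \<partial>M)
      \<le> ennreal (1 / s) * (ennreal ((G / s) powr (q / p')) * ennreal (n powr (q + 1) * (w * (1 / K1) powr q)))"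
    by (rule mult_left_mono) simp
  also have "\<dots> = ennreal (1 / s * ((G / s) powr (q / p') * (n powr (q + 1) * (w * (1 / K1) powr q))))"
    using pos by (simp flip: ennreal_mult)
  also have "1 / s * ((G / s) powr (q / p') * (n powr (q + 1) * (w * (1 / K1) powr q))) =
      n powr ((p' + 1) * (q / p')) * C powr q * n powr (q + 1) * (1 / K1) powr q"
  \<comment> \<open>The cancellation: e q = 1 + q/p', so the power of \<open>s\<close> in
    \<open>B powr q\<close> pays for the outer and the inner average, while its 1/w removes the
    volume from the normalized weight bound.\<close>
  proof -
    have "(G / s) powr (q / p') = n powr ((p' + 1) * (q / p')) * B powr q / s powr (q / p')"
      using p1 by (simp add: G_def powr_divide powr_mult powr_powr)
    moreover have "B powr q = C powr q * s powr (1 + q / p') / w"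
    proof -
      have "e * q = 1 + q / p'" using q by (simp add: e distrib_right)
      then show ?thesis using q pos by (simp add: B_def powr_divide powr_mult powr_powr)
    qed
    moreover have "s powr (1 + q / p') = s * s powr (q / p')" using pos by (simp add: powr_add)
    ultimately show ?thesis using pos by simp
  qed
  finally show ?thesis by (simp add: M_def u_def v_def n_def)
qed

text \<open>Testing bounds each column of R V^(-1/q) almost everywhere, hence its operator norm by n
  B. The inner variable is thus controlled by a constant, and only the normalized weight remains to
  be integrated in x.\<close>

lemma Apq_one_average_le:
  fixes U V :: "real^'d \<Rightarrow> complex^'n^'n"
  assumes \<rho>: "\<And>x. 0 < \<rho> x" and q: "1 \<le> q"
    and \<alpha>: "1 - 1 / q = \<alpha> / real CARD('d)" and K1: "0 < K1" and C: "0 \<le> C"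
    and U: "matrix_weight U" and V: "matrix_weight V" and R: "reducing_operators K1 K2 q U R"
    and l: "0 < l" and bnd: "bounded_Lp_weak_Lq 1 q (averaging_op \<rho> \<theta> \<alpha> q R V c l) C"
    and s: "s = psi \<rho> \<theta> c l * vol c l"
  shows "esssup (restrict_space lebesgue (cube c l)) (\<lambda>y. ennreal (1 / s) * (\<integral>\<^sup>+x. ennreal (op_norm
      (matrix_powr (U x) (1 / q) ** matrix_powr (V y) (- 1 / q)) powr q)
      \<partial>restrict_space lebesgue (cube c l)))
    \<le> ennreal (real CARD('n) powr q * C powr q * real CARD('n) powr (q + 1) * (1 / K1) powr q)"
proof -
  define M where "M = restrict_space lebesgue (cube c l)"
  interpret finite_measure M unfolding M_def using l by (rule finite_measure_cube)
  define u v where "u x = matrix_powr (U x) (1 / q)" and "v y = matrix_powr (V y) (- 1 / q)" for x y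
  have meas [measurable]: "u \<in> borel_measurable M" "v \<in> borel_measurable M"
    unfolding M_def u_def v_def using U V
    by (auto intro!: borel_measurable_cube borel_measurable_matrix_powr)
  have q0: "0 < q" using q by simp
  define n where "n = real CARD('n)"
  define w where "w = vol c l"
  have pos: "0 < s" "0 < w" using \<rho> l by (auto simp: s w_def psi_pos vol_pos)
  have e: "1 - \<alpha> / real CARD('d) = 1 / q" using \<alpha> by simp
  define B where "B = C * s powr (1 / q) / w powr (1 / q)"
  have B: "0 \<le> B" using C by (simp add: B_def)
  obtain S where S: "R c l ** S = mat 1"
    using positive_definite_inverse reducing_operators_cube(1)[OF R l] by metis
  have "AE y in M. norm ((R c l ** v y) *v axis i 1) \<le> B" for i
  proof (rule testing_L1[OF _ B])
    fix f :: "real^'d \<Rightarrow> complex^'n"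
    assume "f \<in> borel_measurable M" "(\<integral>\<^sup>+y. ennreal (norm (f y)) \<partial>M) < top"
    then show "(\<integral>\<^sup>+y. ennreal (norm ((R c l ** v y) *v f y)) \<partial>M) \<le>
        ennreal B * (\<integral>\<^sup>+y. ennreal (norm (f y)) \<partial>M)"
      using averaging_test_bound[OF \<rho> order_refl l C bnd, of f s "1 / q"]
      by (simp add: B_def w_def M_def v_def s e)
  qed auto
  \<comment> \<open>Each column has its own exceptional null set; there are finitely many.\<close>
  then have "AE y in M. \<forall>i\<in>UNIV. norm ((R c l ** v y) *v axis i 1) \<le> B"
    by (intro AE_finite_allI) auto
  then have "AE y in M. op_norm (R c l ** v y) \<le> n * B"
  proof eventually_elim
    case (elim y)
    then have "(\<Sum>i\<in>UNIV. norm ((R c l ** v y) *v axis i 1)) \<le> (\<Sum>i\<in>(UNIV :: 'n set). B)"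
      by (intro sum_mono) auto
    with op_norm_le_columns[of "R c l ** v y"] show ?case by (simp add: n_def)
  qed
  then have "AE y in M. ennreal (1 / s) * (\<integral>\<^sup>+x. ennreal (op_norm (u x ** v y) powr q) \<partial>M) \<le>
      ennreal (n powr q * C powr q * n powr (q + 1) * (1 / K1) powr q)"
  proof eventually_elim
    case (elim y)
    have "(\<integral>\<^sup>+x. ennreal (op_norm (u x ** v y) powr q) \<partial>M) \<le>
        (\<integral>\<^sup>+x. ennreal ((n * B) powr q) * ennreal (op_norm (u x ** S) powr q) \<partial>M)"
    proof (rule nn_integral_mono)
      fix x
      have "op_norm (u x ** v y) powr q \<le> op_norm (u x ** S) powr q * op_norm (R c l ** v y) powr q"
        using q0 by (intro op_norm_factor[OF S]) simp
      also have "\<dots> \<le> op_norm (u x ** S) powr q * (n * B) powr q"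
        using elim q0 by (intro mult_left_mono powr_mono2 op_norm_nonneg) auto
      finally show "ennreal (op_norm (u x ** v y) powr q) \<le>
          ennreal ((n * B) powr q) * ennreal (op_norm (u x ** S) powr q)"
        by (simp add: ennreal_leI mult.commute flip: ennreal_mult)
    qed
    also have "\<dots> = ennreal ((n * B) powr q) * (\<integral>\<^sup>+x. ennreal (op_norm (u x ** S) powr q) \<partial>M)"
      by (rule nn_integral_cmult) measurable
    also have "\<dots> \<le> ennreal ((n * B) powr q) * ennreal (n powr (q + 1) * (w * (1 / K1) powr q))"
      unfolding M_def u_def n_def w_def
      by (intro mult_left_mono nn_integral_normalized_weight_le[OF q0 K1 U R l S]) simp
    finally have "ennreal (1 / s) * (\<integral>\<^sup>+x. ennreal (op_norm (u x ** v y) powr q) \<partial>M) \<le>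
        ennreal (1 / s) * (ennreal ((n * B) powr q) * ennreal (n powr (q + 1) * (w * (1 / K1) powr q)))"
      by (rule mult_left_mono) simp
    also have "\<dots> = ennreal (1 / s * ((n * B) powr q * (n powr (q + 1) * (w * (1 / K1) powr q))))"
      using pos by (simp flip: ennreal_mult)
    \<comment> \<open>The q-th power of \<open>B\<close> is C^q s/w, which cancels both the average
      and the volume.\<close>
    also have "1 / s * ((n * B) powr q * (n powr (q + 1) * (w * (1 / K1) powr q))) =
        n powr q * C powr q * n powr (q + 1) * (1 / K1) powr q"
      using pos q0 by (simp add: B_def powr_mult powr_divide powr_powr)
    finally show ?case .
  qed
  then have "esssup M (\<lambda>y. ennreal (1 / s) * (\<integral>\<^sup>+x. ennreal (op_norm (u x ** v y) powr q) \<partial>M)) \<le>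
      ennreal (n powr q * C powr q * n powr (q + 1) * (1 / K1) powr q)"
    using borel_measurable_kernel(2)[OF meas] by (intro esssup_I) measurable
  then show ?thesis by (simp add: M_def u_def v_def n_def)
qed

lemma Apq_class_if_bounded_averaging:
  fixes U V :: "real^'d \<Rightarrow> complex^'n^'n"
  assumes \<rho>: "\<And>x. 0 < \<rho> x" and p: "1 \<le> p" "p \<le> q"
    and \<alpha>: "1 / p - 1 / q = \<alpha> / real CARD('d)" and K1: "0 < K1"
    and U: "matrix_weight U" and V: "matrix_weight V" and R: "reducing_operators K1 K2 q U R"
    and bnd: "\<And>c l. 0 < l \<Longrightarrow> bounded_Lp_weak_Lq p q (averaging_op \<rho> \<theta> \<alpha> q R V c l) C"
  shows "(U, V) \<in> Apq_class p q \<rho> \<theta>"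
proof -
  \<comment> \<open>A negative constant is read as 0 by \<open>ennreal\<close>, so the change
    preserves the hypothesis and supplies nonnegativity.\<close>
  define C' where "C' = max C 0"
  have C': "0 \<le> C'" by (simp add: C'_def)
  have bnd': "bounded_Lp_weak_Lq p q (averaging_op \<rho> \<theta> \<alpha> q R V c l) C'" if "0 < l" for c l
  proof -
    have "ennreal C' = ennreal C" by (simp add: C'_def max_def ennreal_neg)
    with bnd[OF that, of c] show ?thesis unfolding bounded_Lp_weak_Lq_def by simp
  qed
  have "\<exists>D. Apq_const p q \<rho> \<theta> U V \<le> ennreal D"
  proof (cases "p = 1")
    case True
    have "1 \<le> q" "1 - 1 / q = \<alpha> / real CARD('d)" using p \<alpha> True by auto
    from Apq_one_average_le[where \<rho>=\<rho>, OF \<rho> this K1 C' U V R _ bnd'[unfolded True] refl]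
    show ?thesis
      unfolding Apq_const_def nn_integral_cube if_P[OF True]
      by (intro exI SUP_least) (auto split: prod.splits)
  next
    case False
    then have "1 < p" using p by simp
    from Apq_average_le[where \<rho>=\<rho>, OF \<rho> this p(2) refl \<alpha> K1 C' U V R _ bnd' refl]
    show ?thesis
      unfolding Apq_const_def nn_integral_cube Let_def if_not_P[OF False]
      by (intro exI SUP_least) (auto split: prod.splits)
  qed
  then show ?thesis by (auto simp: Apq_class_def intro: le_less_trans)
qed

theorem theorem1p12:
  fixes \<rho> :: "real^'d \<Rightarrow> real" and \<theta> \<alpha> p q K1 K2 :: real
  assumes "critical_radius \<rho>"
    and "0 \<le> \<theta>"
    and "0 \<le> \<alpha>" and "\<alpha> < real CARD('d)"
    and "1 \<le> p" and "p \<le> q"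
    and "1 / p - 1 / q = \<alpha> / real CARD('d)"
    and "0 < K1" and "0 < K2"
  shows "(\<exists>C>0. \<forall>(U :: real^'d \<Rightarrow> complex^'n^'n) V R.
            matrix_weight U \<and> matrix_weight V \<and> reducing_operators K1 K2 q U R \<and>
            (U, V) \<in> Apq_class p q \<rho> (\<theta> / 3) \<longrightarrow>
            (\<forall>f\<in>Lp_space p. \<forall>c l. 0 < l \<longrightarrow>
               max (weak_Lp_norm q (maximal_op \<rho> \<theta> \<alpha> q R V f))
                   (weak_Lp_norm q (averaging_op \<rho> \<theta> \<alpha> q R V c l f))
               \<le> ennreal C * epowr (Apq_const p q \<rho> (\<theta> / 3) U V) (1 / q) * Lp_norm p f))
       \<and>
         (\<forall>(U :: real^'d \<Rightarrow> complex^'n^'n) V R.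
            matrix_weight U \<and> matrix_weight V \<and> reducing_operators K1 K2 q U R \<and>
            ((\<exists>C. bounded_Lp_weak_Lq p q (maximal_op \<rho> \<theta> \<alpha> q R V) C) \<or>
             (\<exists>C. \<forall>c l. 0 < l \<longrightarrow> bounded_Lp_weak_Lq p q (averaging_op \<rho> \<theta> \<alpha> q R V c l) C)) \<longrightarrow>
            (U, V) \<in> Apq_class p q \<rho> \<theta>)"
proof (intro conjI)
  have \<rho>: "0 < \<rho> x" for x using assms(1) by (simp add: critical_radius_def)
  have \<theta>: "\<theta> / 3 \<le> \<theta>" using assms(2) by simp
  have q: "0 < q" using assms(5,6) by simp
  \<comment> \<open>The origin of the factors: (10 d)^d is the volume ratio of the enlarged cubes,
    its root 1/q belongs to the weak norm, the real dimension 2n counts components, and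
    \<open>K2\<close> is the upper reducing constant.\<close>
  define C where "C = ((10 * real CARD('d)) ^ CARD('d)) powr (1 / q) * (real DIM(complex^'n) * K2)"
  have "C > 0" using assms(9) by (simp add: C_def)
  moreover have "max (weak_Lp_norm q (maximal_op \<rho> \<theta> \<alpha> q R V f))
      (weak_Lp_norm q (averaging_op \<rho> \<theta> \<alpha> q R V c l f))
      \<le> ennreal C * epowr (Apq_const p q \<rho> (\<theta> / 3) U V) (1 / q) * Lp_norm p f"
    if "matrix_weight U" "matrix_weight V" "reducing_operators K1 K2 q U R"
      "(U, V) \<in> Apq_class p q \<rho> (\<theta> / 3)" "f \<in> Lp_space p" "0 < l"
    for U V :: "real^'d \<Rightarrow> complex^'n^'n" and R f c l
  proof -
    have "Apq_const p q \<rho> (\<theta> / 3) U V < top" using that(4) by (simp add: Apq_class_def)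
    from weak_maximal_le[OF \<rho> \<theta> assms(5,6,7,9) that(1-3,5) this]
    have "weak_Lp_norm q (maximal_op \<rho> \<theta> \<alpha> q R V f) \<le>
        ennreal C * epowr (Apq_const p q \<rho> (\<theta> / 3) U V) (1 / q) * Lp_norm p f"
      by (simp only: C_def)
    with weak_averaging_le_maximal[OF that(6) q, of \<rho> \<theta> \<alpha> R V c f] show ?thesis
      by (auto intro: order_trans)
  qed
  ultimately show "\<exists>C>0. \<forall>(U :: real^'d \<Rightarrow> complex^'n^'n) V R.
      matrix_weight U \<and> matrix_weight V \<and> reducing_operators K1 K2 q U R \<and>
      (U, V) \<in> Apq_class p q \<rho> (\<theta> / 3) \<longrightarrow>
      (\<forall>f\<in>Lp_space p. \<forall>c l. 0 < l \<longrightarrow>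
         max (weak_Lp_norm q (maximal_op \<rho> \<theta> \<alpha> q R V f))
             (weak_Lp_norm q (averaging_op \<rho> \<theta> \<alpha> q R V c l f))
         \<le> ennreal C * epowr (Apq_const p q \<rho> (\<theta> / 3) U V) (1 / q) * Lp_norm p f)"
    by blast
  show "\<forall>(U :: real^'d \<Rightarrow> complex^'n^'n) V R.
      matrix_weight U \<and> matrix_weight V \<and> reducing_operators K1 K2 q U R \<and>
      ((\<exists>C. bounded_Lp_weak_Lq p q (maximal_op \<rho> \<theta> \<alpha> q R V) C) \<or>
       (\<exists>C. \<forall>c l. 0 < l \<longrightarrow> bounded_Lp_weak_Lq p q (averaging_op \<rho> \<theta> \<alpha> q R V c l) C)) \<longrightarrow>
      (U, V) \<in> Apq_class p q \<rho> \<theta>"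
  proof (intro allI impI)
    fix U V :: "real^'d \<Rightarrow> complex^'n^'n" and R
    assume *: "matrix_weight U \<and> matrix_weight V \<and> reducing_operators K1 K2 q U R \<and>
      ((\<exists>C. bounded_Lp_weak_Lq p q (maximal_op \<rho> \<theta> \<alpha> q R V) C) \<or>
       (\<exists>C. \<forall>c l. 0 < l \<longrightarrow> bounded_Lp_weak_Lq p q (averaging_op \<rho> \<theta> \<alpha> q R V c l) C))"
    \<comment> \<open>Both alternatives of the hypothesis are brought to the second, with the same
      constant for all cubes.\<close>
    have "\<exists>C. \<forall>c l. 0 < l \<longrightarrow> bounded_Lp_weak_Lq p q (averaging_op \<rho> \<theta> \<alpha> q R V c l) C"
      using * weak_averaging_le_maximal[OF _ q, of _ \<rho> \<theta> \<alpha> R V]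
      unfolding bounded_Lp_weak_Lq_def by (meson order_trans)
    then obtain C where "0 < l \<Longrightarrow> bounded_Lp_weak_Lq p q (averaging_op \<rho> \<theta> \<alpha> q R V c l) C" for c l
      by blast
    with * show "(U, V) \<in> Apq_class p q \<rho> \<theta>"
      using Apq_class_if_bounded_averaging[where \<rho>=\<rho>, OF \<rho> assms(5,6,7,8)] by blast
  qed
qed

end
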